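(* Let $a>b\ge 2$ be integers and let $F=P_a\cup P_b$ be the vertex-disjoint union of a path on $a$ vertices and a path on $b$ vertices. Let $G_F(n)$ be the $n$-vertex graph consisting of a set $U$ of $\lfloor a/2\rfloor+\lfloor b/2\rfloor-1$ universal vertices (each adjacent to all other vertices), where the graph $G_F(n)-U$ on the remaining $n-|U|$ vertices consists of a single edge plus isolated vertices if both $a$ and $b$ are odd, and has no edges otherwise. Let $G$ be any $F$-free graph on $n$ vertices with $n\ge \binom{a}{\lfloor a/2\rfloor}^2a^4b^4$. Then $e(G)\le e(G_F(n))$, with equality only when $G\cong G_F(n)$.
   Context: $P_m$ denotes the path on $m$ vertices; $e(G)$ denotes the number of edges of $G$. A graph is $F$-free if it does not contain $F$ as a subgraph. *)

theory Defs
  imports Main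
begin

definition simple_graph :: "'a set \<Rightarrow> 'a set set \<Rightarrow> bool" where
  "simple_graph V E \<longleftrightarrow> finite V \<and>
     (\<forall>e\<in>E. \<exists>x y. x \<in> V \<and> y \<in> V \<and> x \<noteq> y \<and> e = {x, y})"

definition contains_subgraph :: "'b set \<Rightarrow> 'b set set \<Rightarrow> 'a set \<Rightarrow> 'a set set \<Rightarrow> bool" where
  "contains_subgraph VH EH V E \<longleftrightarrow>
     (\<exists>f. inj_on f VH \<and> f ` VH \<subseteq> V \<and> (\<forall>e\<in>EH. f ` e \<in> E))"

definition two_paths_V :: "nat \<Rightarrow> nat \<Rightarrow> nat set" where
  "two_paths_V a b = {0..<a+b}"

definition two_paths_E :: "nat \<Rightarrow> nat \<Rightarrow> nat set set" where
  "two_paths_E a b = {{i, Suc i} | i. Suc i < a} \<union> {{a + i, a + Suc i} | i. Suc i < b}"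

definition GF_V :: "nat \<Rightarrow> nat set" where
  "GF_V n = {0..<n}"

definition GF_E :: "nat \<Rightarrow> nat \<Rightarrow> nat \<Rightarrow> nat set set" where
  "GF_E a b n = (let k = a div 2 + b div 2 - 1 in
     {{x, y} | x y. x < n \<and> y < n \<and> x \<noteq> y \<and>
        (x < k \<or> y < k \<or> (odd a \<and> odd b \<and> x = k \<and> y = Suc k))})"

definition graph_iso :: "'a set \<Rightarrow> 'a set set \<Rightarrow> 'b set \<Rightarrow> 'b set set \<Rightarrow> bool" where
  "graph_iso V E W D \<longleftrightarrow>
     (\<exists>f. bij_betw f V W \<and> (\<forall>x\<in>V. \<forall>y\<in>V. {x, y} \<in> E \<longleftrightarrow> {f x, f y} \<in> D))"

end

theory Submission
  imports Defs "HOL.Binomial_Plus"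
begin

text \<open>
  Let \<open>k = a div 2 + b div 2 - 1\<close>, let \<open>e(S)\<close> be the number of edges inside \<open>S\<close>, and suppose that \<open>G\<close> has at least
  as many edges as \<open>G\<^sub>F(n)\<close>. The heart of the proof is to find a set \<open>U\<close> of \<open>k\<close> vertices with many common
  neighbours. First pass to a large vertex set \<open>S\<close> inside which all degrees are at least \<open>k\<close>. By the
  Erdos--Gallai theorem \<open>S\<close> spans a path on \<open>a\<close> vertices, and the rest of \<open>S\<close> contains no path on \<open>b\<close>
  vertices, hence has few edges; so many vertices have \<open>a div 2\<close> neighbours on the path, and by
  pigeonhole some \<open>a div 2\<close> of its vertices, forming a set \<open>A\<close>, have a large common neighbourhood \<open>X\<close>.
  In \<open>S - A\<close>, where degrees are at least \<open>b div 2 - 1\<close>, there are two disjoint paths starting in \<open>X\<close>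
  with \<open>b - 1\<close> vertices in total. A vertex of \<open>A\<close> joins them to a path on \<open>b\<close> vertices, and if two
  disjoint edges at \<open>X\<close> were left over, then together with the rest of \<open>A\<close> they would give a path on \<open>a\<close>
  vertices. So almost every vertex of \<open>X\<close> has all its neighbours in \<open>S - A\<close> among at most \<open>b + 1\<close>
  vertices, and a second pigeonhole extends \<open>A\<close> to \<open>U\<close>.

  Given \<open>U\<close>, any path off \<open>U\<close> that is attached to \<open>U\<close> can be prolonged through \<open>U\<close> and its common
  neighbours, so edges off \<open>U\<close> are nearly always unattached to \<open>U\<close>, and a vertex of such an edge
  contributes less than a vertex joined to all of \<open>U\<close>.
\<close>

section \<open>Paths and the Erdos--Gallai theorem\<close>

locale sgraph =
  fixes E :: "'a set set"
  assumes edge_pair: "e \<in> E \<Longrightarrow> \<exists>x y. x \<noteq> y \<and> e = {x, y}"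
begin

definition adj :: "'a \<Rightarrow> 'a \<Rightarrow> bool" where
  "adj x y \<longleftrightarrow> {x, y} \<in> E"

definition nb :: "'a set \<Rightarrow> 'a \<Rightarrow> 'a set" where
  "nb S x = {y \<in> S. adj x y}"

definition edges_in :: "'a set \<Rightarrow> 'a set set" where
  "edges_in S = {e \<in> E. e \<subseteq> S}"

text \<open>A path is encoded by its list of vertices, so that \<open>length\<close> is the m of
  P_m; the empty list counts as a path.\<close>

definition gpath :: "'a list \<Rightarrow> bool" where
  "gpath xs \<longleftrightarrow> distinct xs \<and> successively adj xs"

lemma adj_sym: "adj x y \<Longrightarrow> adj y x"
  by (simp add: adj_def insert_commute)

lemma adj_commute: "adj x y \<longleftrightarrow> adj y x"
  using adj_sym by blast

lemma adj_irrefl [simp]: "\<not> adj x x"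
  using edge_pair[of "{x}"] by (auto simp: adj_def doubleton_eq_iff)

lemma edges_inE:
  assumes "e \<in> edges_in S"
  obtains x y where "e = {x, y}" "adj x y" "x \<in> S" "y \<in> S"
proof -
  have "e \<in> E" "e \<subseteq> S" using assms by (auto simp: edges_in_def)
  moreover obtain x y where "e = {x, y}" using edge_pair[OF \<open>e \<in> E\<close>] by blast
  ultimately show thesis using that by (simp add: adj_def)
qed

lemma finite_nb [simp]: "finite S \<Longrightarrow> finite (nb S x)"
  by (simp add: nb_def)

lemma nb_subset: "nb S x \<subseteq> S"
  by (auto simp: nb_def)

lemma finite_edges_in [simp]: "finite S \<Longrightarrow> finite (edges_in S)"
  by (rule finite_subset[of _ "Pow S"]) (auto simp: edges_in_def)

lemma edges_in_empty [simp]: "edges_in {} = {}"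
  using edge_pair by (fastforce simp: edges_in_def)

section \<open>Edge counts under adding a vertex and splitting a vertex set\<close>

lemma card_edges_in_insert:
  assumes "finite S" "x \<notin> S"
  shows "card (edges_in (insert x S)) = card (edges_in S) + card (nb S x)"
proof -
  have eq: "edges_in (insert x S) = edges_in S \<union> (\<lambda>y. {x, y}) ` nb S x"
  proof (intro equalityI subsetI)
    fix e assume e: "e \<in> edges_in (insert x S)"
    then obtain u v where uv: "u \<noteq> v" "e = {u, v}" "e \<in> E"
      using edge_pair unfolding edges_in_def by blast
    show "e \<in> edges_in S \<union> (\<lambda>y. {x, y}) ` nb S x"
    proof (cases "x \<in> e")
      case True
      then obtain y where "y \<noteq> x" "e = {x, y}" using uv by (metis doubleton_eq_iff insertE singletonD)
      then show ?thesis using e by (auto simp: edges_in_def nb_def adj_def)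
    next
      case False
      then show ?thesis using e by (auto simp: edges_in_def)
    qed
  next
    fix e assume "e \<in> edges_in S \<union> (\<lambda>y. {x, y}) ` nb S x"
    then show "e \<in> edges_in (insert x S)"
      by (auto simp: edges_in_def nb_def adj_def)
  qed
  have "inj_on (\<lambda>y. {x, y}) (nb S x)"
    by (auto simp: inj_on_def doubleton_eq_iff)
  moreover have "edges_in S \<inter> (\<lambda>y. {x, y}) ` nb S x = {}"
    using assms by (auto simp: edges_in_def)
  ultimately show ?thesis
    unfolding eq using assms by (simp add: card_Un_disjoint card_image)
qed

lemma card_edges_in_remove:
  assumes "finite S" "x \<in> S"
  shows "card (edges_in S) = card (edges_in (S - {x})) + card (nb S x)"
proof -
  have "nb (S - {x}) x = nb S x" by (auto simp: nb_def)
  then show ?thesis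
    using card_edges_in_insert[of "S - {x}" x] assms by (simp add: insert_absorb)
qed

lemma card_edges_in_Un:
  assumes "finite S" "finite T" "S \<inter> T = {}"
  shows "card (edges_in (S \<union> T)) = card (edges_in S) + card (edges_in T) + (\<Sum>x\<in>T. card (nb S x))"
  using assms(2,3)
proof (induction T rule: finite_induct)
  case empty
  then show ?case by simp
next
  case (insert x T)
  have "nb (S \<union> T) x = nb S x \<union> nb T x" by (auto simp: nb_def)
  moreover have "nb S x \<inter> nb T x = {}" using insert.prems by (auto simp: nb_def)
  ultimately have "card (nb (S \<union> T) x) = card (nb S x) + card (nb T x)"
    using assms(1) insert.hyps by (simp add: card_Un_disjoint)
  moreover have "card (edges_in (S \<union> insert x T)) = card (edges_in (S \<union> T)) + card (nb (S \<union> T) x)"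
    using card_edges_in_insert[of "S \<union> T" x] assms(1) insert by simp
  ultimately show ?case
    using insert card_edges_in_insert[of T x] by simp
qed

lemma card_edges_in_complete_le:
  assumes "finite S"
  shows "2 * card (edges_in S) \<le> card S * (card S - 1)"
  using assms
proof (induction S rule: finite_induct)
  case (insert x S)
  have "card (nb S x) \<le> card S" using insert nb_subset by (simp add: card_mono)
  then have "2 * card (edges_in (insert x S)) \<le> card S * (card S - 1) + 2 * card S"
    using insert card_edges_in_insert[of S x] by simp
  also have "\<dots> = card (insert x S) * (card (insert x S) - 1)"
    using insert by (cases "card S") (auto simp: algebra_simps)
  finally show ?case .
qed simp

text \<open>Edges inside \<open>S\<close> and edges from \<open>x\<close> to \<open>S\<close> are
  each at most their value in a clique, so equality in the sum forces equality in both. This makes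
  \<open>U\<close> a clique in the extremal case.\<close>

lemma card_edges_in_complete_iff:
  assumes "finite S"
  shows "2 * card (edges_in S) = card S * (card S - 1) \<longleftrightarrow> (\<forall>x\<in>S. \<forall>y\<in>S. x \<noteq> y \<longrightarrow> adj x y)"
  using assms
proof (induction S rule: finite_induct)
  case (insert x S)
  have le: "card (nb S x) \<le> card S" using insert nb_subset by (simp add: card_mono)
  have le2: "2 * card (edges_in S) \<le> card S * (card S - 1)"
    using card_edges_in_complete_le insert by blast
  have eq: "card (insert x S) * (card (insert x S) - 1) = card S * (card S - 1) + 2 * card S"
    using insert by (cases "card S") (auto simp: algebra_simps)
  have e: "card (edges_in (insert x S)) = card (edges_in S) + card (nb S x)"
    using insert card_edges_in_insert[of S x] by simp
  have "card (nb S x) = card S \<longleftrightarrow> nb S x = S"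
    using insert nb_subset card_subset_eq by metis
  also have "\<dots> \<longleftrightarrow> (\<forall>y\<in>S. adj x y)" by (auto simp: nb_def)
  finally have c: "card (nb S x) = card S \<longleftrightarrow> (\<forall>y\<in>S. adj x y)" .
  have "2 * card (edges_in (insert x S)) = card (insert x S) * (card (insert x S) - 1) \<longleftrightarrow>
      2 * card (edges_in S) = card S * (card S - 1) \<and> card (nb S x) = card S"
    using le le2 unfolding eq e by (auto simp del: One_nat_def)
  also have "\<dots> \<longleftrightarrow> (\<forall>u\<in>insert x S. \<forall>v\<in>insert x S. u \<noteq> v \<longrightarrow> adj u v)"
    using insert.hyps unfolding insert.IH c by (auto intro: adj_sym)
  finally show ?case .
qed simp

section \<open>Paths as vertex lists\<close>

lemma gpath_Nil [simp]: "gpath []" and gpath_single [simp]: "gpath [x]"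
  by (auto simp: gpath_def)

lemma gpath_append:
  "gpath (xs @ ys) \<longleftrightarrow> gpath xs \<and> gpath ys \<and> set xs \<inter> set ys = {} \<and>
     (xs = [] \<or> ys = [] \<or> adj (last xs) (hd ys))"
  by (auto simp: gpath_def successively_append_iff)

lemma gpath_Cons:
  "gpath (x # ys) \<longleftrightarrow> gpath ys \<and> x \<notin> set ys \<and> (ys = [] \<or> adj x (hd ys))"
  using gpath_append[of "[x]" ys] by auto

lemma gpath_edge: "adj x y \<Longrightarrow> gpath [x, y]"
  by (auto simp: gpath_Cons)

lemma gpath_P3: "adj x y \<Longrightarrow> adj y z \<Longrightarrow> x \<noteq> z \<Longrightarrow> gpath [x, y, z]"
  by (auto simp: gpath_Cons)

lemma gpath_rev [simp]: "gpath (rev xs) \<longleftrightarrow> gpath xs"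
proof -
  have "(\<lambda>x y. adj y x) = adj" using adj_commute by blast
  then have "successively (\<lambda>x y. adj y x) xs = successively adj xs" by (rule arg_cong)
  then show ?thesis by (simp add: gpath_def)
qed

lemma gpath_take: "gpath xs \<Longrightarrow> gpath (take n xs)"
  and gpath_drop: "gpath xs \<Longrightarrow> gpath (drop n xs)"
  using gpath_append[of "take n xs" "drop n xs"] by auto

lemma gpath_nth_adj: "gpath xs \<Longrightarrow> Suc i < length xs \<Longrightarrow> adj (xs ! i) (xs ! Suc i)"
  by (auto simp: gpath_def successively_conv_nth)

lemma gpath_length_le:
  assumes "finite S" "gpath xs" "set xs \<subseteq> S"
  shows "length xs \<le> card S"
  using assms card_mono[of S "set xs"] distinct_card[of xs] by (simp add: gpath_def)

lemma longest_path:
  assumes "finite S" "P xs0" "gpath xs0" "set xs0 \<subseteq> S"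
  obtains xs where "P xs" "gpath xs" "set xs \<subseteq> S"
    "\<And>ys. P ys \<Longrightarrow> gpath ys \<Longrightarrow> set ys \<subseteq> S \<Longrightarrow> length ys \<le> length xs"
proof -
  let ?Q = "\<lambda>xs. P xs \<and> gpath xs \<and> set xs \<subseteq> S"
  have "\<forall>ys. ?Q ys \<longrightarrow> length ys < Suc (card S)"
    using gpath_length_le[OF assms(1)] by (auto simp: less_Suc_eq_le)
  then obtain xs where "?Q xs" "\<forall>ys. ?Q ys \<longrightarrow> length ys \<le> length xs"
    using ex_has_greatest_nat[of ?Q xs0 length] assms by blast
  then show thesis using that by blast
qed

definition path_free :: "nat \<Rightarrow> 'a set \<Rightarrow> bool" where
  "path_free m S \<longleftrightarrow> (\<forall>xs. gpath xs \<and> set xs \<subseteq> S \<longrightarrow> length xs < m)"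

lemma path_free_subset: "path_free m S \<Longrightarrow> T \<subseteq> S \<Longrightarrow> path_free m T"
  unfolding path_free_def by blast

lemma not_path_freeE:
  assumes "\<not> path_free m S"
  obtains xs where "gpath xs" "set xs \<subseteq> S" "length xs = m"
proof -
  obtain xs where "gpath xs" "set xs \<subseteq> S" "m \<le> length xs"
    using assms by (auto simp: path_free_def not_less)
  then show thesis using that[of "take m xs"] set_take_subset[of m xs] gpath_take by auto
qed

text \<open>A longest path whose end vertices have large degree closes up to a cycle by Posa rotation;
  maximality then forces its vertex set to be a union of components.\<close>

lemma longest_path_isolated:
  assumes fin: "finite S" and path: "gpath v" "set v \<subseteq> S" "v \<noteq> []"
    and max: "\<And>ys. gpath ys \<Longrightarrow> set ys \<subseteq> S \<Longrightarrow> length ys \<le> length v"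
    and deg: "length v \<le> card (nb S (hd v)) + card (nb S (last v))"
    and z: "z \<in> S - set v"
  shows "nb (set v) z = {}"
proof (rule ccontr)
  assume "nb (set v) z \<noteq> {}"
  then obtain y where y: "y \<in> set v" "adj z y" by (auto simp: nb_def)
  let ?l = "length v"
  have dist: "distinct v" using path by (simp add: gpath_def)
  have hd_nb: "nb S (hd v) \<subseteq> set v"
  proof
    fix x assume x: "x \<in> nb S (hd v)"
    show "x \<in> set v"
    proof (rule ccontr)
      assume "x \<notin> set v"
      then have "gpath (x # v)" using path x by (auto simp: gpath_Cons nb_def intro: adj_sym)
      then show False using max[of "x # v"] path x by (auto simp: nb_def)
    qed
  qed
  have last_nb: "nb S (last v) \<subseteq> set v"
  proof
    fix x assume x: "x \<in> nb S (last v)"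
    show "x \<in> set v"
    proof (rule ccontr)
      assume "x \<notin> set v"
      then have "gpath (v @ [x])" using path x by (auto simp: gpath_append nb_def)
      then show False using max[of "v @ [x]"] path x by (auto simp: nb_def)
    qed
  qed
  \<comment> \<open>\<open>I\<close> records the predecessors on \<open>v\<close> of the neighbours
    of the first vertex, \<open>J\<close> the positions of the neighbours of the last one. Both lie
    among \<open>length v - 1\<close> indices, so the degree hypothesis makes them meet.\<close>
  define I where "I = {i. Suc i < ?l \<and> adj (hd v) (v ! Suc i)}"
  define J where "J = {i. Suc i < ?l \<and> adj (last v) (v ! i)}"
  have finI: "finite I" and finJ: "finite J" unfolding I_def J_def by (rule finite_subset[of _ "{..<?l}"], auto)+
  have "nb S (hd v) \<subseteq> (\<lambda>i. v ! Suc i) ` I"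
  proof
    fix x assume x: "x \<in> nb S (hd v)"
    then obtain j where j: "j < ?l" "x = v ! j" using hd_nb by (metis in_set_conv_nth subsetD)
    have "j \<noteq> 0" using j x path by (metis (no_types, lifting) adj_irrefl hd_conv_nth mem_Collect_eq nb_def)
    then obtain i where "j = Suc i" by (cases j) auto
    then show "x \<in> (\<lambda>i. v ! Suc i) ` I" using j x by (auto simp: I_def nb_def)
  qed
  then have cI: "card (nb S (hd v)) \<le> card I"
    using finI by (meson card_image_le card_mono finite_imageI le_trans)
  have "nb S (last v) \<subseteq> (\<lambda>i. v ! i) ` J"
  proof
    fix x assume x: "x \<in> nb S (last v)"
    then obtain j where j: "j < ?l" "x = v ! j" using last_nb by (metis in_set_conv_nth subsetD)
    have "j \<noteq> ?l - 1" using j x path by (auto simp: nb_def last_conv_nth)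
    then show "x \<in> (\<lambda>i. v ! i) ` J" using j x by (auto simp: J_def nb_def)
  qed
  then have cJ: "card (nb S (last v)) \<le> card J"
    using finJ by (meson card_image_le card_mono finite_imageI le_trans)
  have "card (I \<union> J) \<le> ?l - 1"
  proof -
    have "I \<union> J \<subseteq> {..<?l - 1}" by (auto simp: I_def J_def)
    then show ?thesis using card_mono[of "{..<?l - 1}" "I \<union> J"] by simp
  qed
  moreover have "0 < ?l" using path by simp
  moreover have "card (I \<union> J) + card (I \<inter> J) = card I + card J"
    using card_Un_Int[OF finI finJ] by simp
  ultimately have "card (I \<inter> J) > 0" using cI cJ deg by linarith
  then obtain i where i: "Suc i < ?l" "adj (hd v) (v ! Suc i)" "adj (last v) (v ! i)"
    by (auto simp: I_def J_def card_gt_0_iff)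
  \<comment> \<open>With i in both sets, going from the first vertex up to \<open>v ! i\<close>,
    jumping to the last vertex and walking back to \<open>v ! Suc i\<close> gives a path whose two
    ends are adjacent, that is, a cycle on \<open>set v\<close>.\<close>
  define c where "c = take (Suc i) v @ rev (drop (Suc i) v)"
  have tl: "last (take (Suc i) v) = v ! i" using i by (simp add: take_Suc_conv_app_nth)
  have hd_drop: "hd (drop (Suc i) v) = v ! Suc i" using i by (simp add: hd_drop_conv_nth)
  have c: "gpath c" "set c = set v" "length c = ?l"
  proof -
    have "gpath (take (Suc i) v @ drop (Suc i) v)" using path by simp
    then have "gpath (take (Suc i) v)" "gpath (drop (Suc i) v)"
      "set (take (Suc i) v) \<inter> set (drop (Suc i) v) = {}"
      unfolding gpath_append by blast+
    then show "gpath c" unfolding c_def gpath_append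
      using tl i by (auto simp: hd_rev adj_commute)
    show "set c = set v" unfolding c_def
      by (metis append_take_drop_id set_append set_rev)
    show "length c = ?l" unfolding c_def by simp
  qed
  have hd_c: "hd c = hd v" using path unfolding c_def by (cases v) auto
  have last_c: "last c = v ! Suc i" using i hd_drop unfolding c_def by (auto simp: last_rev)
  obtain c1 c2 where c12: "c = c1 @ y # c2" using y c(2) by (metis split_list)
  \<comment> \<open>The cycle is cut open just before \<open>y\<close>, so that \<open>z\<close> can
    be put in front and yields a longer path.\<close>
  have "gpath ((y # c2) @ c1)"
  proof (cases "c1 = []")
    case True
    then show ?thesis using c c12 by simp
  next
    case False
    have "adj (last (y # c2)) (hd c1)"
      using last_c hd_c c12 False i by (simp add: adj_commute)
    then show ?thesis using c(1) unfolding c12 gpath_append by auto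
  qed
  moreover have "z \<notin> set ((y # c2) @ c1)" using z c(2) c12 by auto
  ultimately have "gpath (z # (y # c2) @ c1)" using y by (simp add: gpath_Cons)
  moreover have "set (z # (y # c2) @ c1) \<subseteq> S" using z c(2) c12 path by auto
  ultimately show False using max[of "z # (y # c2) @ c1"] c(3) c12 by simp
qed

text \<open>Induction on the size of \<open>S\<close>: a vertex of degree at most (m - 2)/2 can be
  deleted. Otherwise a longest path spans a union of components with fewer than m vertices; there
  the clique bound suffices, and the rest of \<open>S\<close> is handled by induction.\<close>

theorem Erdos_Gallai:
  assumes "finite S" "path_free m S"
  shows "2 * card (edges_in S) \<le> (m - 2) * card S"
  using assms
proof (induction "card S" arbitrary: S rule: less_induct)
  case less
  show ?case
  proof (cases "\<exists>x\<in>S. 2 * card (nb S x) \<le> m - 2")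
    case True
    then obtain x where x: "x \<in> S" "2 * card (nb S x) \<le> m - 2" by blast
    have lt: "card (S - {x}) < card S" using x less.prems by (meson card_Diff1_less)
    have "2 * card (edges_in (S - {x})) \<le> (m - 2) * card (S - {x})"
      using less.hyps[OF lt] less.prems path_free_subset[of m S "S - {x}"] by auto
    then have "2 * card (edges_in S) \<le> (m - 2) * card (S - {x}) + (m - 2)"
      using card_edges_in_remove[OF less.prems(1) x(1)] x by linarith
    also have "\<dots> = (m - 2) * Suc (card (S - {x}))" by simp
    also have "Suc (card (S - {x})) = card S"
      using card.remove[of S x] x less.prems by metis
    finally show ?thesis .
  next
    case False
    then have deg: "\<And>x. x \<in> S \<Longrightarrow> m - 1 \<le> 2 * card (nb S x)" by (force simp: not_le)
    show ?thesis
    proof (cases "S = {}")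
      case True
      then show ?thesis by simp
    next
      case False
      then obtain x0 where "x0 \<in> S" by blast
      then obtain v where v: "v \<noteq> []" "gpath v" "set v \<subseteq> S"
        and max: "\<And>ys. ys \<noteq> [] \<Longrightarrow> gpath ys \<Longrightarrow> set ys \<subseteq> S \<Longrightarrow> length ys \<le> length v"
        using longest_path[of S "\<lambda>xs. xs \<noteq> []" "[x0]"] less.prems(1) by auto
      have max': "length ys \<le> length v" if "gpath ys" "set ys \<subseteq> S" for ys
        using max[of ys] that by (cases "ys = []") auto
      have lm: "length v < m" using less.prems v by (auto simp: path_free_def)
      have "hd v \<in> S" "last v \<in> S" using v by auto
      \<comment> \<open>Both end degrees are at least (m - 1)/2, and the path has at most m - 1
        vertices.\<close>
      then have "length v \<le> card (nb S (hd v)) + card (nb S (last v))"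
        using lm deg[of "hd v"] deg[of "last v"] by linarith
      then have "\<And>z. z \<in> S - set v \<Longrightarrow> nb (set v) z = {}"
        using longest_path_isolated[OF less.prems(1) v(2,3,1) max'] by blast
      then have sum0: "(\<Sum>x\<in>S - set v. card (nb (set v) x)) = 0" by simp
      have S: "set v \<union> (S - set v) = S" using v by blast
      have e: "card (edges_in S) = card (edges_in (set v)) + card (edges_in (S - set v))"
        using card_edges_in_Un[of "set v" "S - set v"] sum0 less.prems unfolding S by simp
      have cv: "card (set v) = length v" using v by (simp add: gpath_def distinct_card)
      have cS: "card S = length v + card (S - set v)"
        using card_Un_disjoint[of "set v" "S - set v"] less.prems unfolding S cv by simp
      then have "card (S - set v) < card S" using v by simp
      then have "2 * card (edges_in (S - set v)) \<le> (m - 2) * card (S - set v)"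
        using less.hyps[of "S - set v"] less.prems path_free_subset[of m S "S - set v"] by auto
      moreover have "2 * card (edges_in (set v)) \<le> (m - 2) * length v"
      proof -
        have "2 * card (edges_in (set v)) \<le> length v * (length v - 1)"
          using card_edges_in_complete_le[of "set v"] cv by simp
        also have "\<dots> \<le> length v * (m - 2)" using lm by (intro mult_le_mono2) linarith
        finally show ?thesis by (simp add: mult.commute)
      qed
      ultimately show ?thesis unfolding e cS by (simp add: algebra_simps)
    qed
  qed
qed

subsection \<open>Paths through joined sets\<close>

definition joined :: "'a set \<Rightarrow> 'a set \<Rightarrow> bool" where
  "joined S T \<longleftrightarrow> (\<forall>x\<in>S. \<forall>y\<in>T. adj x y)"

lemma joined_mono: "joined S T \<Longrightarrow> S' \<subseteq> S \<Longrightarrow> T' \<subseteq> T \<Longrightarrow> joined S' T'"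
  unfolding joined_def by blast

lemma joined_disjoint: "joined S T \<Longrightarrow> S \<inter> T = {}"
  unfolding joined_def by (meson adj_irrefl disjoint_iff)

text \<open>The path runs through \<open>p\<close>, then alternates between all \<open>t + 1\<close>
  vertices of \<open>T\<close> and \<open>t\<close> vertices of \<open>X\<close>, then runs through
  \<open>q\<close>. The last vertex used from \<open>T\<close> is not controlled, so all of
  \<open>T\<close> has to be adjacent to the head of \<open>q\<close>.\<close>

lemma link_path:
  assumes "finite T" "card T = Suc t" "u \<in> T" "gpath p" "gpath q" "p \<noteq> []" "q \<noteq> []"
    "set p \<inter> set q = {}" "adj (last p) u" "\<And>v. v \<in> T \<Longrightarrow> adj v (hd q)" "joined T X"
    "T \<inter> (set p \<union> set q) = {}" "X \<inter> (set p \<union> set q) = {}" "finite X" "t \<le> card X"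
  shows "\<exists>r. gpath r \<and> set r \<subseteq> set p \<union> set q \<union> T \<union> X \<and> length r = length p + length q + 2 * t + 1"
  using assms
proof (induction t arbitrary: T u p X)
  case 0
  then have "gpath (p @ [u] @ q)"
    by (auto simp: gpath_append gpath_Cons)
  then show ?case using 0 by (intro exI[of _ "p @ [u] @ q"]) auto
next
  case (Suc t)
  obtain x where x: "x \<in> X" using Suc.prems by fastforce
  have cT: "card (T - {u}) = Suc t" using Suc.prems by simp
  then obtain u' where u': "u' \<in> T - {u}" by (metis card.empty ex_in_conv Zero_not_Suc)
  have TX: "T \<inter> X = {}" using Suc.prems joined_disjoint by blast
  have "adj u x" "adj x u'" using Suc.prems x u' adj_sym by (auto simp: joined_def)
  moreover have "u \<notin> set p" "x \<notin> set p" "x \<noteq> u" "u \<notin> set q" "x \<notin> set q"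
    using Suc.prems x TX by auto
  ultimately have p': "gpath (p @ [u, x])" "set (p @ [u, x]) \<inter> set q = {}" "adj (last (p @ [u, x])) u'"
    using Suc.prems by (auto simp: gpath_append gpath_Cons)
  \<comment> \<open>One step of the alternation: \<open>u\<close> and \<open>x\<close> are moved to
    the end of \<open>p\<close>, and \<open>u'\<close> takes the place of \<open>u\<close>.\<close>
  have "\<exists>r. gpath r \<and> set r \<subseteq> set (p @ [u, x]) \<union> set q \<union> (T - {u}) \<union> (X - {x}) \<and>
      length r = length (p @ [u, x]) + length q + 2 * t + 1"
  proof (rule Suc.IH[OF _ cT u' p'(1) _ _ _ p'(2,3)])
    show "joined (T - {u}) (X - {x})" by (rule joined_mono[OF Suc.prems(11)]) auto
    show "\<And>v. v \<in> T - {u} \<Longrightarrow> adj v (hd q)" using Suc.prems(10) by blast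
    show "(T - {u}) \<inter> (set (p @ [u, x]) \<union> set q) = {}" using Suc.prems(12) x TX by auto
    show "(X - {x}) \<inter> (set (p @ [u, x]) \<union> set q) = {}" using Suc.prems(3,13) TX by auto
    show "t \<le> card (X - {x})" using Suc.prems(14,15) x by simp
  qed (use Suc.prems(1,5,7,14) in simp_all)
  then obtain r where r: "gpath r" "set r \<subseteq> set (p @ [u, x]) \<union> set q \<union> (T - {u}) \<union> (X - {x})"
      "length r = length (p @ [u, x]) + length q + 2 * t + 1" by blast
  have "set r \<subseteq> set p \<union> set q \<union> T \<union> X" using r(2) x Suc.prems(3) by auto
  then show ?case using r by auto
qed

text \<open>\<open>link_path\<close> between two single vertices of \<open>X\<close>: an alternating
  path through all of \<open>T\<close> with both ends in \<open>X\<close>.\<close>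

lemma plain_path:
  assumes T: "finite T" "1 \<le> card T" and X: "joined T X" "finite X" "Suc (card T) \<le> card X"
  shows "\<exists>r. gpath r \<and> set r \<subseteq> T \<union> X \<and> length r = 2 * card T + 1"
proof -
  obtain t where t: "card T = Suc t" using T by (cases "card T") auto
  obtain u where u: "u \<in> T" using T by fastforce
  obtain x where x: "x \<in> X" using X by fastforce
  have "card (X - {x}) = card X - 1" using x X by simp
  then have "1 \<le> card (X - {x})" using X t by linarith
  then obtain y where y: "y \<in> X - {x}" by (metis card.empty ex_in_conv not_one_le_zero)
  have cX: "t \<le> card (X - {x, y})" using card_Diff_subset[of "{x,y}" X] x y X t by auto
  have TX: "T \<inter> X = {}" using X joined_disjoint by blast
  have "\<exists>r. gpath r \<and> set r \<subseteq> set [x] \<union> set [y] \<union> T \<union> (X - {x, y}) \<and>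
      length r = length [x] + length [y] + 2 * t + 1"
    by (rule link_path[OF T(1) t u])
      (use x y u X TX cX in \<open>auto simp: joined_def intro: adj_sym\<close>)
  then obtain r where r: "gpath r" "set r \<subseteq> set [x] \<union> set [y] \<union> T \<union> (X - {x, y})"
      "length r = length [x] + length [y] + 2 * t + 1" by blast
  have "set r \<subseteq> T \<union> X" using r(2) x y by auto
  then show ?thesis using r t by auto
qed

section \<open>A pigeonhole argument, and two disjoint paths starting in a given set\<close>

lemma common_neighbours:
  assumes "finite Y" "finite P" "Y \<noteq> {}" and deg: "\<And>y. y \<in> Y \<Longrightarrow> m \<le> card (nb P y)"
  obtains A X where "A \<subseteq> P" "card A = m" "X \<subseteq> Y" "joined A X" "card Y \<le> (card P choose m) * card X"
proof -
  have "\<exists>A. A \<subseteq> nb P y \<and> card A = m" if "y \<in> Y" for y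
    using obtain_subset_with_card_n[OF deg[OF that]] by metis
  then obtain f where f: "\<And>y. y \<in> Y \<Longrightarrow> f y \<subseteq> nb P y \<and> card (f y) = m" by metis
  define F where "F = {A. A \<subseteq> P \<and> card A = m}"
  \<comment> \<open>The vertices of \<open>Y\<close> are grouped by the m-subset chosen inside their
    neighbourhoods; a largest group has at least average size and is completely joined to its
    m-subset.\<close>
  define fib where "fib A = {y \<in> Y. f y = A}" for A
  have F: "finite F" "card F = card P choose m"
    using assms(2) by (auto simp: F_def n_subsets)
  have "f y \<in> F" if "y \<in> Y" for y
    using f[OF that] nb_subset[of P y] by (auto simp: F_def)
  then have fY: "f ` Y \<subseteq> F" by blast
  then have "F \<noteq> {}" using fY assms(3) by blast
  then have "Max ((\<lambda>A. card (fib A)) ` F) \<in> (\<lambda>A. card (fib A)) ` F"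
    using F by (intro Max_in) auto
  then obtain A where A: "A \<in> F" "card (fib A) = Max ((\<lambda>A. card (fib A)) ` F)" by auto
  have "card Y = (\<Sum>A\<in>F. card (fib A))"
    using sum.group[of Y F f "\<lambda>_. 1::nat"] F fY assms(1) by (simp add: fib_def)
  also have "\<dots> \<le> card F * card (fib A)"
  proof -
    have "card (fib B) \<le> card (fib A)" if "B \<in> F" for B
      unfolding A(2) using that F by (intro Max_ge) auto
    then show ?thesis using sum_bounded_above[of F "\<lambda>A. card (fib A)" "card (fib A)"] by simp
  qed
  finally have le: "card Y \<le> (card P choose m) * card (fib A)" unfolding F(2) .
  have "joined A (fib A)"
    using f adj_sym unfolding joined_def fib_def nb_def by blast
  moreover have "fib A \<subseteq> Y" by (auto simp: fib_def)
  ultimately show thesis using that[of A "fib A"] A(1) le by (simp add: F_def)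
qed

text \<open>\<open>I\<close> and its shift by one are disjoint subsets of the interval from p to
  q.\<close>

lemma sparse_index_set:
  assumes "finite I" "\<And>i. i \<in> I \<Longrightarrow> p \<le> i \<and> i < q \<and> Suc i \<notin> I" "I \<noteq> {}"
  shows "2 * card I + p \<le> Suc q"
proof -
  have "I \<inter> Suc ` I = {}" using assms by auto
  then have "card (I \<union> Suc ` I) = 2 * card I"
    using assms(1) by (simp add: card_Un_disjoint card_image)
  moreover have "card (I \<union> Suc ` I) \<le> card {p..q}"
    by (rule card_mono) (use assms(2) in \<open>force+\<close>)
  moreover have "p \<le> q" using assms by fastforce
  ultimately show ?thesis by simp
qed

text \<open>A longest path starting in \<open>X\<close> either has \<open>b - 2\<close> vertices, or leaves room for a second long
  path. Otherwise a maximal path off it would end in a vertex with too many non-consecutive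
  neighbours on the first path.\<close>

lemma two_paths_from_set:
  assumes fin: "finite H" and XH: "X \<subseteq> H" and free: "path_free b H" and cX: "b \<le> card X"
    and deg: "\<And>x. x \<in> H \<Longrightarrow> d \<le> card (nb H x)" and b: "2 * d + 2 \<le> b" "b \<le> 2 * d + 3" "1 \<le> d"
  shows "\<exists>R R'. gpath R \<and> gpath R' \<and> R \<noteq> [] \<and> R' \<noteq> [] \<and> hd R \<in> X \<and> hd R' \<in> X \<and>
    set R \<subseteq> H \<and> set R' \<subseteq> H \<and> set R \<inter> set R' = {} \<and> length R + length R' = b - 1"
proof -
  have finX: "finite X" using XH fin finite_subset by blast
  have "X \<noteq> {}" using cX b by auto
  then obtain x0 where "x0 \<in> X" by blast
  then obtain v where v: "v \<noteq> [] \<and> hd v \<in> X" "gpath v" "set v \<subseteq> H"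
    and vmax: "\<And>ys. ys \<noteq> [] \<and> hd ys \<in> X \<Longrightarrow> gpath ys \<Longrightarrow> set ys \<subseteq> H \<Longrightarrow> length ys \<le> length v"
    using longest_path[of H "\<lambda>xs. xs \<noteq> [] \<and> hd xs \<in> X" "[x0]"] fin XH by auto
  let ?l = "length v"
  have lb: "?l < b" using free v by (simp add: path_free_def)
  have "card (set v) < card X" using card_length[of v] lb cX by linarith
  then have "\<not> X \<subseteq> set v" using card_mono[of "set v" X] by auto
  then obtain x where x: "x \<in> X" "x \<notin> set v" by blast
  then have xH: "x \<in> H" using XH by blast
  show ?thesis
  proof (cases "b - 2 \<le> ?l")
    case True
    \<comment> \<open>Here b - 2 vertices of \<open>v\<close> together with the single vertex
      \<open>x\<close> give the total b - 1.\<close>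
    have "take (b - 2) v \<noteq> []" "hd (take (b - 2) v) = hd v" using v b by (cases v; auto)+
    then show ?thesis
      using v x True XH b set_take_subset[of "b - 2" v]
      by (intro exI[of _ "take (b - 2) v"] exI[of _ "[x]"]) (auto intro: gpath_take)
  next
    case False
    obtain w where w: "w \<noteq> [] \<and> hd w = x" "gpath w" "set w \<subseteq> H - set v"
      and wmax: "\<And>ys. ys \<noteq> [] \<and> hd ys = x \<Longrightarrow> gpath ys \<Longrightarrow> set ys \<subseteq> H - set v \<Longrightarrow> length ys \<le> length w"
      using longest_path[of "H - set v" "\<lambda>xs. xs \<noteq> [] \<and> hd xs = x" "[x]"] fin x xH by auto
    let ?p = "length w"
    have wX: "hd w \<in> X" using w x by simp
    have wv: "set w \<inter> set v = {}" "set w \<subseteq> H" using w by auto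
    have "?p \<le> ?l" using vmax[of w] w wX wv by blast
    show ?thesis
    proof (cases "Suc d \<le> ?p")
      case True
      \<comment> \<open>\<open>v\<close> is at least as long as \<open>w\<close>, hence has at least
        d + 1 vertices, and b - 2 - d is at most d + 1 because b is at most 2d + 3.\<close>
      let ?R = "take (b - 2 - d) v" and ?R' = "take (Suc d) w"
      have pos: "0 < b - 2 - d" using b by linarith
      have "?R \<noteq> []" "hd ?R = hd v" "?R' \<noteq> []" "hd ?R' = hd w"
        using v w pos by (auto simp: hd_take)
      moreover have "gpath ?R" "gpath ?R'" using v w by (auto intro: gpath_take)
      moreover have "set ?R \<subseteq> set v" "set ?R' \<subseteq> set w" by (auto dest: in_set_takeD)
      moreover have "length ?R + length ?R' = b - 1" using \<open>?p \<le> ?l\<close> True b by simp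
      ultimately show ?thesis
        using v wX wv by (intro exI[of _ ?R] exI[of _ ?R']) auto
    next
      case pd: False
      let ?y = "last w"
      have yw: "?y \<in> set w" using w by simp
      then have y: "?y \<in> set w" "?y \<in> H" "?y \<notin> set v" using wv by blast+
      \<comment> \<open>Since \<open>w\<close> cannot be prolonged off \<open>v\<close>, its last
        vertex has neighbours only on \<open>v\<close> and \<open>w\<close>, and at most
        \<open>length w - 1\<close> of them on \<open>w\<close>.\<close>
      have sub: "nb H ?y \<subseteq> nb (set v) ?y \<union> (set w - {?y})"
      proof
        fix z assume z: "z \<in> nb H ?y"
        then have "z \<noteq> ?y" by (auto simp: nb_def)
        moreover have "z \<in> set v \<union> set w"
        proof (rule ccontr)
          assume nz: "z \<notin> set v \<union> set w"
          then have "gpath (w @ [z])" "set (w @ [z]) \<subseteq> H - set v" "w @ [z] \<noteq> [] \<and> hd (w @ [z]) = x"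
            using w z by (auto simp: gpath_append nb_def)
          then show False using wmax[of "w @ [z]"] by simp
        qed
        ultimately show "z \<in> nb (set v) ?y \<union> (set w - {?y})" using z by (auto simp: nb_def)
      qed
      have "card (set w - {?y}) = ?p - 1"
        using w y distinct_card[of w] by (simp add: gpath_def)
      then have "card (nb H ?y) \<le> card (nb (set v) ?y) + (?p - 1)"
        using card_mono[OF _ sub] card_Un_le[of "nb (set v) ?y" "set w - {?y}"] by simp
      then have dy: "Suc d \<le> card (nb (set v) ?y) + ?p"
        using deg[OF y(2)] w by (cases w) auto
      define I where "I = {i. i < ?l \<and> adj ?y (v ! i)}"
      have finI: "finite I" by (auto simp: I_def)
      have "nb (set v) ?y \<subseteq> (!) v ` I"
        by (auto simp: nb_def I_def in_set_conv_nth)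
      then have "card (nb (set v) ?y) \<le> card I"
        using finI by (meson card_image_le card_mono finite_imageI le_trans)
      then have dI: "Suc d \<le> card I + ?p" using dy by linarith
      then have "I \<noteq> {}" using pd by auto
      \<comment> \<open>Each bound compares \<open>v\<close> with another path starting in
        \<open>X\<close>: \<open>w\<close> followed by \<open>v\<close> from position i onwards,
        \<open>w\<close> followed by \<open>v\<close> backwards from i, and \<open>v\<close> with
        the end of \<open>w\<close> inserted between positions i and i + 1.\<close>
      have bounds: "?p \<le> i \<and> i < ?l - ?p \<and> Suc i \<notin> I" if "i \<in> I" for i
      proof -
        have i: "i < ?l" "adj ?y (v ! i)" using that by (auto simp: I_def)
        have td: "gpath (take (Suc i) v @ drop (Suc i) v)" using v by simp
        have sets: "set (take (Suc i) v) \<subseteq> set v" "set (drop i v) \<subseteq> set v" "set (drop (Suc i) v) \<subseteq> set v"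
          by (auto dest: in_set_takeD in_set_dropD)
        have last_take: "last (take (Suc i) v) = v ! i" using i by (simp add: take_Suc_conv_app_nth)
        have "gpath (w @ drop i v)"
          unfolding gpath_append using w wv sets i v by (auto simp: hd_drop_conv_nth intro: gpath_drop)
        moreover have "set (w @ drop i v) \<subseteq> H" "hd (w @ drop i v) \<in> X" using wv sets v w wX by auto
        ultimately have "length (w @ drop i v) \<le> ?l" using vmax[of "w @ drop i v"] w by simp
        then have 1: "?p \<le> i" using i by simp
        have "gpath (w @ rev (take (Suc i) v))"
          unfolding gpath_append using w wv sets i v last_take by (auto simp: hd_rev intro: gpath_take)
        moreover have "set (w @ rev (take (Suc i) v)) \<subseteq> H" "hd (w @ rev (take (Suc i) v)) \<in> X"
          using wv sets v w wX by auto
        ultimately have "length (w @ rev (take (Suc i) v)) \<le> ?l"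
          using vmax[of "w @ rev (take (Suc i) v)"] w by simp
        then have 2: "i < ?l - ?p" using i by simp
        have 3: "Suc i \<notin> I"
        proof
          assume "Suc i \<in> I"
          then have si: "Suc i < ?l" "adj ?y (v ! Suc i)" by (auto simp: I_def)
          have "gpath (?y # drop (Suc i) v)"
            using si y sets v by (auto simp: gpath_Cons hd_drop_conv_nth intro: gpath_drop)
          then have "gpath (take (Suc i) v @ ?y # drop (Suc i) v)"
            using td y sets last_take i unfolding gpath_append by (auto intro: adj_sym)
          moreover have "set (take (Suc i) v @ ?y # drop (Suc i) v) \<subseteq> H" using sets v y by auto
          moreover have "hd (take (Suc i) v @ ?y # drop (Suc i) v) \<in> X" using v by (cases v) auto
          ultimately have "length (take (Suc i) v @ ?y # drop (Suc i) v) \<le> ?l"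
            using vmax[of "take (Suc i) v @ ?y # drop (Suc i) v"] by simp
          then show False using si by simp
        qed
        show ?thesis using 1 2 3 by blast
      qed
      have "2 * card I + ?p \<le> Suc (?l - ?p)"
        by (rule sparse_index_set[OF finI bounds \<open>I \<noteq> {}\<close>])
      \<comment> \<open>With at least d + 1 - p neighbours on \<open>v\<close>, where p is the
        length of \<open>w\<close>, the terms in p cancel and \<open>v\<close> has at least 2d + 1
        vertices, against its length being below b - 2.\<close>
      then have False using dI pd False b(2) by linarith
      then show ?thesis ..
    qed
  qed
qed

end

section \<open>Finding many common neighbours of \<open>k\<close> vertices\<close>

locale two_path_free = sgraph E for E :: "'a set set" +
  fixes V :: "'a set" and a b :: nat
  assumes finV: "finite V"
    and F_free: "\<And>p q. gpath p \<Longrightarrow> gpath q \<Longrightarrow> set p \<subseteq> V \<Longrightarrow> set q \<subseteq> V \<Longrightarrow> set p \<inter> set q = {} \<Longrightarrow>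
      a \<le> length p \<Longrightarrow> b \<le> length q \<Longrightarrow> False"
    and b2: "2 \<le> b" and ba: "b < a"
begin

section \<open>Forbidden configurations: paths prolonged through a joined set\<close>

lemma finite_subV: "S \<subseteq> V \<Longrightarrow> finite S"
  using finV finite_subset by blast

text \<open>\<open>U\<close> supplies two disjoint parts of sizes t and t'. The first links
  \<open>p\<close> and \<open>q\<close> using t - 1 vertices of \<open>X\<close>, the second carries
  an alternating path using t' + 1 further ones; hence t + t' vertices of \<open>X\<close> off
  \<open>p\<close> and \<open>q\<close> are enough.\<close>

lemma link_and_plain_path:
  assumes U: "U \<subseteq> V" and X: "X \<subseteq> V" "joined U X"
    and p: "gpath p" "p \<noteq> []" "set p \<subseteq> V - U" and q: "gpath q" "q \<noteq> []" "set q \<subseteq> V - U"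
    and pq: "set p \<inter> set q = {}" and u: "u \<in> U" "adj (last p) u"
    and hq: "\<And>v. v \<in> U \<Longrightarrow> adj v (hd q)"
    and t: "1 \<le> t" "1 \<le> t'" "t + t' \<le> card U" and c: "length p + length q + t + t' \<le> card X"
  shows "\<exists>r r'. gpath r \<and> gpath r' \<and> set r \<subseteq> V \<and> set r' \<subseteq> V \<and> set r \<inter> set r' = {} \<and>
     length r + 1 = length p + length q + 2 * t \<and> length r' = 2 * t' + 1"
proof -
  have finU: "finite U" and finX: "finite X" using U X finite_subV by auto
  have UX: "U \<inter> X = {}" using X joined_disjoint by blast
  have "card (U - {u}) = card U - 1" using u finU by simp
  then have "t - 1 \<le> card (U - {u})" using t by linarith
  then obtain T0 where T0: "T0 \<subseteq> U - {u}" "card T0 = t - 1" "finite T0"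
    using obtain_subset_with_card_n by metis
  define T where "T = insert u T0"
  have "u \<notin> T0" using T0 by blast
  then have T: "T \<subseteq> U" "card T = Suc (t - 1)" "u \<in> T" "finite T" using T0 u t by (auto simp: T_def)
  have "card (U - T) = card U - t" using T finU t by (simp add: card_Diff_subset)
  then have "t' \<le> card (U - T)" using t by linarith
  then obtain T' where T': "T' \<subseteq> U - T" "card T' = t'" "finite T'"
    using obtain_subset_with_card_n by metis
  have "card (set p \<union> set q) \<le> length p + length q"
    by (metis add_mono card_Un_le card_length le_trans)
  then have cY: "t + t' \<le> card (X - (set p \<union> set q))"
    using c diff_card_le_card_Diff[of "set p \<union> set q" X] by simp
  then have "t - 1 \<le> card (X - (set p \<union> set q))" by linarith
  then obtain Y where Y: "Y \<subseteq> X - (set p \<union> set q)" "card Y = t - 1" "finite Y"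
    using obtain_subset_with_card_n by metis
  have "card (X - (set p \<union> set q) - Y) = card (X - (set p \<union> set q)) - card Y"
    using card_Diff_subset[OF Y(3,1)] .
  then have cY': "Suc (card T') \<le> card (X - (set p \<union> set q) - Y)" using cY Y T' t by linarith
  have "\<exists>r. gpath r \<and> set r \<subseteq> set p \<union> set q \<union> T \<union> Y \<and> length r = length p + length q + 2 * (t - 1) + 1"
    by (rule link_path[OF T(4,2,3) p(1) q(1) p(2) q(2) pq u(2)])
      (use T Y p q hq X in \<open>auto intro: joined_mono\<close>)
  then obtain r where r: "gpath r" "set r \<subseteq> set p \<union> set q \<union> T \<union> Y"
    "length r = length p + length q + 2 * (t - 1) + 1" by blast
  have "\<exists>r'. gpath r' \<and> set r' \<subseteq> T' \<union> (X - (set p \<union> set q) - Y) \<and> length r' = 2 * card T' + 1"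
    by (rule plain_path) (use T' t cY' X finX in \<open>auto intro: joined_mono\<close>)
  then obtain r' where r': "gpath r'" "set r' \<subseteq> T' \<union> (X - (set p \<union> set q) - Y)" "length r' = 2 * card T' + 1"
    by blast
  have "set r \<subseteq> V" using r(2) p(3) q(3) T(1) U Y(1) X(1) by blast
  moreover have "set r' \<subseteq> V" using r'(2) T'(1) U X(1) by blast
  moreover have "set r \<inter> set r' = {}" using r(2) r'(2) T' T Y UX p q by blast
  moreover have "length r + 1 = length p + length q + 2 * t" using r(3) t by simp
  moreover have "length r' = 2 * t' + 1" using r'(3) T'(2) by simp
  ultimately show ?thesis using r(1) r'(1) by blast
qed

lemma no_link_and_plain_path:
  assumes "U \<subseteq> V" "X \<subseteq> V" "joined U X"
    "gpath p" "p \<noteq> []" "set p \<subseteq> V - U" "gpath q" "q \<noteq> []" "set q \<subseteq> V - U"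
    "set p \<inter> set q = {}" "u \<in> U" "adj (last p) u" "\<And>v. v \<in> U \<Longrightarrow> adj v (hd q)"
    "1 \<le> t" "1 \<le> t'" "t + t' \<le> card U" "length p + length q + t + t' \<le> card X"
    and len: "a + 1 \<le> length p + length q + 2 * t \<and> b \<le> 2 * t' + 1 \<or>
      b + 1 \<le> length p + length q + 2 * t \<and> a \<le> 2 * t' + 1"
  shows False
proof -
  obtain r r' where r: "gpath r" "gpath r'" "set r \<subseteq> V" "set r' \<subseteq> V" "set r \<inter> set r' = {}"
     "length r + 1 = length p + length q + 2 * t" "length r' = 2 * t' + 1"
    using link_and_plain_path[OF assms(1-17)] by blast
  have "set r' \<inter> set r = {}" using r(5) by blast
  moreover have "a \<le> length r \<and> b \<le> length r' \<or> b \<le> length r \<and> a \<le> length r'"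
    using len r(6,7) by linarith
  ultimately show False using F_free[of r r'] F_free[of r' r] r by blast
qed

text \<open>The case in which \<open>q\<close> is one vertex of \<open>X\<close>: each of the t
  vertices of \<open>U\<close> prolongs \<open>p\<close> by two vertices.\<close>

lemma no_half_and_plain_path:
  assumes U: "U \<subseteq> V" and X: "X \<subseteq> V" "joined U X"
    and p: "gpath p" "p \<noteq> []" "set p \<subseteq> V - U" and u: "u \<in> U" "adj (last p) u"
    and t: "1 \<le> t" "1 \<le> t'" "t + t' \<le> card U" and c: "length p + 1 + t + t' \<le> card X"
    and len: "a \<le> length p + 2 * t \<and> b \<le> 2 * t' + 1 \<or> b \<le> length p + 2 * t \<and> a \<le> 2 * t' + 1"
  shows False
proof -
  have "card X - card (set p) \<le> card (X - set p)" by (simp add: diff_card_le_card_Diff)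
  then have "1 \<le> card (X - set p)" using c card_length[of p] by linarith
  then obtain x where x: "x \<in> X - set p" by (metis card.empty ex_in_conv not_one_le_zero)
  then have "x \<notin> U" using X joined_disjoint by blast
  then show False
    using no_link_and_plain_path[OF U X p _ _ _ _ u _ t, of "[x]"] x X c len by (auto simp: joined_def)
qed

text \<open>A path on b vertices avoiding \<open>T\<close> leaves enough of \<open>X\<close> for an
  alternating path through \<open>T\<close> with 2(a div 2) + 1, hence at least a, vertices.\<close>

lemma path_free_Diff:
  assumes T: "T \<subseteq> V" "card T = a div 2" and X: "X \<subseteq> V" "joined T X" "a + b \<le> card X"
  shows "path_free b (V - T)"
proof (rule ccontr)
  assume "\<not> path_free b (V - T)"
  then obtain q where q: "gpath q" "set q \<subseteq> V - T" "length q = b" by (rule not_path_freeE)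
  have "card X - card (set q) \<le> card (X - set q)" by (simp add: diff_card_le_card_Diff)
  then have "a \<le> card (X - set q)" using X q card_length[of q] by linarith
  then have "Suc (card T) \<le> card (X - set q)" using T ba b2 by linarith
  moreover have "1 \<le> card T" using T ba b2 by linarith
  moreover have "joined T (X - set q)" using X joined_mono by blast
  ultimately obtain r where r: "gpath r" "set r \<subseteq> T \<union> (X - set q)" "length r = 2 * card T + 1"
    using plain_path[of T "X - set q"] finite_subV T X by (meson finite_Diff)
  have "set r \<inter> set q = {}" "set r \<subseteq> V" "a \<le> length r" using r q T X by auto
  then show False using F_free[of r q] r q by auto
qed

section \<open>The number k and a dense vertex set\<close>

definition k where "k = a div 2 + b div 2 - 1"

lemma halves: "k + 1 = a div 2 + b div 2" "1 \<le> b div 2" "b div 2 \<le> a div 2"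
  using b2 ba by (simp_all add: k_def div_le_mono)

text \<open>The first bound rests on a > b. It puts (b - 2)/2, the edge density that Erdos-Gallai
  allows off \<open>U\<close>, strictly below k.\<close>

lemma k_ge: "b - 1 \<le> k" "a div 2 \<le> k" "1 \<le> k" "k \<le> a - 1" "b \<le> 2 * k"
  using halves b2 ba by linarith+

text \<open>Maximising \<open>2 e(S) - (2k - 1) |S|\<close> makes every degree in \<open>S\<close> at least \<open>k\<close>; that the coefficient is
  below \<open>2k\<close> forces \<open>S\<close> to be large, since \<open>e(S)\<close> is at most \<open>(k + 1) |S|\<close>.\<close>

lemma dense_subset:
  assumes e: "k * (k - 1) + 2 * (k * (card V - k)) \<le> 2 * card (edges_in V)" and kV: "k \<le> card V"
  obtains S where "S \<subseteq> V" "\<And>x. x \<in> S \<Longrightarrow> k \<le> card (nb S x)" "card V \<le> 3 * card S + a * a"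
    "2 * k * card S \<le> 2 * card (edges_in S) + k * (k + 1)"
proof -
  \<comment> \<open>Integers are used because the difference may be negative.\<close>
  define phi where "phi S = 2 * int (card (edges_in S)) - (2 * int k - 1) * int (card S)" for S
  have "Max (phi ` Pow V) \<in> phi ` Pow V" using finV by (intro Max_in) auto
  then obtain S where S: "S \<subseteq> V" "phi S = Max (phi ` Pow V)" by auto
  have max: "phi T \<le> phi S" if "T \<subseteq> V" for T
    unfolding S(2) using that finV by (intro Max_ge) auto
  have finS: "finite S" using S finite_subV by blast
  have "int (k * (k - 1) + 2 * (k * (card V - k))) = 2 * int k * int (card V) - int k * (int k + 1)"
  proof -
    obtain m j where "card V = k + m" "k = Suc j" using kV k_ge(3) by (metis le_Suc_ex plus_1_eq_Suc)
    then show ?thesis by (simp add: algebra_simps)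
  qed
  then have eV: "2 * int k * int (card V) - int k * (int k + 1) \<le> 2 * int (card (edges_in V))"
    using e by linarith
  then have phiV: "int (card V) - int k * (int k + 1) \<le> phi V" by (simp add: phi_def algebra_simps)
  have phiS: "int (card V) - int k * (int k + 1) \<le> phi S" using phiV max[of V] by simp
  have 1: "k \<le> card (nb S x)" if x: "x \<in> S" for x
  proof -
    have "phi (S - {x}) \<le> phi S" using S by (intro max) blast
    moreover have "int (card (S - {x})) = int (card S) - 1"
      using card.remove[OF finS x] by linarith
    moreover have "int (card (edges_in S)) = int (card (edges_in (S - {x}))) + int (card (nb S x))"
      using card_edges_in_remove[OF finS x] by linarith
    ultimately have "2 * int k - 1 \<le> 2 * int (card (nb S x))"
      by (simp add: phi_def algebra_simps)
    then show ?thesis by linarith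
  qed
  \<comment> \<open>A path on a + b vertices would split into the two forbidden paths. Erdos-Gallai
    then bounds \<open>phi S\<close> by three times the size of \<open>S\<close>.\<close>
  have free: "path_free (a + b) S"
  proof (rule ccontr)
    assume "\<not> path_free (a + b) S"
    then obtain xs where xs: "gpath xs" "set xs \<subseteq> S" "length xs = a + b" by (rule not_path_freeE)
    have "gpath (take a xs @ drop a xs)" using xs by simp
    then have "gpath (take a xs)" "gpath (drop a xs)" "set (take a xs) \<inter> set (drop a xs) = {}"
      unfolding gpath_append by blast+
    moreover have "set (take a xs) \<subseteq> V" "set (drop a xs) \<subseteq> V"
      using xs(2) S(1) by (auto dest: in_set_takeD in_set_dropD)
    ultimately show False using F_free[of "take a xs" "drop a xs"] xs(3) by simp
  qed
  have "a + b - 2 \<le> 2 * k + 2" using halves by linarith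
  then have "(a + b - 2) * card S \<le> (2 * k + 2) * card S" by (rule mult_le_mono1)
  then have "2 * card (edges_in S) \<le> (2 * k + 2) * card S"
    using Erdos_Gallai[OF finS free] by linarith
  then have "int (2 * card (edges_in S)) \<le> int ((2 * k + 2) * card S)" by (simp only: of_nat_le_iff)
  then have "phi S \<le> 3 * int (card S)" by (simp add: phi_def algebra_simps)
  moreover have kk: "int k * (int k + 1) \<le> int (a * a)"
  proof -
    have "k * (k + 1) \<le> a * a" using k_ge(4) ba by (intro mult_le_mono) linarith+
    then have "int (k * (k + 1)) \<le> int (a * a)" by (simp only: of_nat_le_iff)
    then show ?thesis by (simp add: algebra_simps)
  qed
  ultimately have "int (card V) \<le> int (3 * card S + a * a)" using phiS by simp
  then have 2: "card V \<le> 3 * card S + a * a" by (simp only: of_nat_le_iff)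
  \<comment> \<open>The bound on \<open>phi S\<close> from below by the size of \<open>V\<close> is
    weakened to one by the size of \<open>S\<close>.\<close>
  have "int (card S) \<le> int (card V)" using card_mono[OF finV S(1)] by simp
  then have "int (2 * k * card S) \<le> int (2 * card (edges_in S) + k * (k + 1))"
    using phiS by (simp add: phi_def algebra_simps)
  then have 3: "2 * k * card S \<le> 2 * card (edges_in S) + k * (k + 1)" by (simp only: of_nat_le_iff)
  show thesis using that[OF S(1) 1 2 3] .
qed

text \<open>Take a path \<open>P\<close> on a vertices in \<open>S\<close> and let \<open>R\<close>
  be the rest of \<open>S\<close>. The edges inside \<open>R\<close>, together with a div 2 - 1
  edges from each vertex of \<open>R\<close> to \<open>P\<close>, fall short of k per vertex of
  \<open>R\<close>; so linearly many vertices of \<open>R\<close> send more edges to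
  \<open>P\<close>, and the pigeonhole applies to them.\<close>

lemma large_join:
  assumes SV: "S \<subseteq> V" and e: "2 * k * card S \<le> 2 * card (edges_in S) + k * (k + 1)"
    and big: "2 * (a * a) < card S"
  obtains A X where "A \<subseteq> S" "card A = a div 2" "X \<subseteq> S" "joined A X"
    "card S \<le> 2 * (a * a) + 2 * a * ((a choose (a div 2)) * card X)"
proof -
  have finS: "finite S" using SV finite_subV by blast
  have kk: "k * (k + 1) \<le> a * a" using k_ge(4) ba by (intro mult_le_mono) linarith+
  have "\<not> path_free a S"
  proof
    assume "path_free a S"
    then have "2 * card (edges_in S) \<le> (a - 2) * card S" by (rule Erdos_Gallai[OF finS])
    moreover have "Suc (a - 2) * card S \<le> 2 * k * card S"
      using k_ge(2) ba b2 by (intro mult_le_mono1) linarith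
    ultimately have "card S \<le> k * (k + 1)" using e by simp
    then show False using kk big by linarith
  qed
  then obtain p where p: "gpath p" "set p \<subseteq> S" "length p = a" by (rule not_path_freeE)
  define P where "P = set p"
  define R where "R = S - P"
  have cP: "card P = a" using p distinct_card[of p] by (simp add: P_def gpath_def)
  have finP: "finite P" "finite R" using finS by (auto simp: P_def R_def)
  have PR: "P \<union> R = S" "P \<inter> R = {}" using p by (auto simp: P_def R_def)
  have "path_free b R"
  proof (rule ccontr)
    assume "\<not> path_free b R"
    then obtain q where "gpath q" "set q \<subseteq> R" "length q = b" by (rule not_path_freeE)
    then show False using F_free[of p q] p SV by (auto simp: R_def P_def)
  qed
  then have eR: "2 * card (edges_in R) \<le> (b - 2) * card R" using Erdos_Gallai finP by blast
  have eP: "2 * card (edges_in P) \<le> a * (a - 1)" using card_edges_in_complete_le[OF finP(1)] cP by simp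
  define N where "N = {r \<in> R. a div 2 \<le> card (nb P r)}"
  \<comment> \<open>A vertex of \<open>N\<close> is charged a extra edges on top of the a div 2 - 1
    allowed to everyone.\<close>
  have "(\<Sum>r\<in>R. card (nb P r)) \<le> (\<Sum>r\<in>R. (if a div 2 \<le> card (nb P r) then a else 0) + (a div 2 - 1))"
  proof (rule sum_mono)
    fix r
    have "card (nb P r) \<le> a" using card_mono[OF finP(1) nb_subset] cP by metis
    then show "card (nb P r) \<le> (if a div 2 \<le> card (nb P r) then a else 0) + (a div 2 - 1)" by auto
  qed
  also have "\<dots> = a * card N + (a div 2 - 1) * card R"
    using finP by (simp add: sum.distrib N_def sum.If_cases Collect_conj_eq mult.commute)
  finally have sum: "(\<Sum>r\<in>R. card (nb P r)) \<le> a * card N + (a div 2 - 1) * card R" .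
  have eS: "card (edges_in S) = card (edges_in P) + card (edges_in R) + (\<Sum>r\<in>R. card (nb P r))"
    using card_edges_in_Un[OF finP PR(2)] PR(1) by simp
  \<comment> \<open>The summand 1 is the deficit of each vertex of \<open>R\<close> in twice the
    edge count; it must be made up by \<open>N\<close>, up to terms of order a * a.\<close>
  have bk: "((b - 2) + 2 * (a div 2 - 1) + 1) * card R \<le> 2 * k * card R"
    using halves ba b2 by (intro mult_le_mono1) linarith
  have cSR: "card S = card R + a" using card_Un_disjoint[OF finP PR(2)] PR(1) cP by simp
  have kS: "2 * k * card S = 2 * k * card R + 2 * k * a" unfolding cSR by (simp add: algebra_simps)
  have aa: "a * (a - 1) + a = a * a" using ba by (cases a) auto
  have ak: "a \<le> 2 * k * a" using k_ge(3) by simp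
  have bR: "((b - 2) + 2 * (a div 2 - 1) + 1) * card R = (b - 2) * card R + 2 * ((a div 2 - 1) * card R) + card R"
    by (simp add: algebra_simps)
  have arith: "x \<le> 2 * eS' + kk' \<Longrightarrow> eS' = eP' + eR' + sum' \<Longrightarrow> 2 * eP' \<le> aa \<Longrightarrow> 2 * eR' \<le> bR \<Longrightarrow>
      sum' \<le> aN + sR \<Longrightarrow> y \<le> kR \<Longrightarrow> x = kR + ka \<Longrightarrow> cS = cR + a \<Longrightarrow> aa + a = aaa \<Longrightarrow> a \<le> ka \<Longrightarrow>
      y = bR + 2 * sR + cR \<Longrightarrow> kk' \<le> aaa \<Longrightarrow> cS \<le> 2 * aaa + 2 * aN"
    for x eS' kk' eP' eR' sum' aa bR aN sR y kR ka cS cR aaa :: nat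
    by (simp add: algebra_simps)
  have cS: "card S \<le> 2 * (a * a) + 2 * (a * card N)"
    by (rule arith[OF e eS eP eR sum bk kS cSR aa ak bR kk])
  then have "card N \<noteq> 0" using big by (intro notI) simp
  then have N: "N \<noteq> {}" "finite N" by (auto simp: card_eq_0_iff)
  have degN: "\<And>y. y \<in> N \<Longrightarrow> a div 2 \<le> card (nb P y)" by (simp add: N_def)
  obtain A X where A: "A \<subseteq> P" "card A = a div 2" "X \<subseteq> N" "joined A X"
    and c: "card N \<le> (card P choose (a div 2)) * card X"
    using common_neighbours[OF N(2) finP(1) N(1) degN] by blast
  have "a * card N \<le> a * ((a choose (a div 2)) * card X)" using c unfolding cP by (rule mult_le_mono2)
  then have "card S \<le> 2 * (a * a) + 2 * a * ((a choose (a div 2)) * card X)" using cS unfolding mult.assoc by linarith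
  moreover have "A \<subseteq> S" "X \<subseteq> S" using A PR by (auto simp: N_def)
  ultimately show thesis using that A by blast
qed

lemma no_two_edges_off_paths:
  assumes A: "A \<subseteq> V" "card A = a div 2" and X: "X \<subseteq> V" "joined A X" "3 * a \<le> card X"
    and R: "gpath R" "gpath R'" "R \<noteq> []" "R' \<noteq> []" "hd R \<in> X" "hd R' \<in> X"
      "set R \<subseteq> V - A" "set R' \<subseteq> V - A" "set R \<inter> set R' = {}" "length R + length R' = b - 1"
    and b4: "4 \<le> b"
    and xy: "x \<in> X" "y \<in> V - A" "adj x y" and xy': "x' \<in> X" "y' \<in> V - A" "adj x' y'"
    and dis: "distinct [x, y, x', y']" "{x, y, x', y'} \<inter> (set R \<union> set R') = {}"
  shows False
proof -
  have AX: "A \<inter> X = {}" using X joined_disjoint by blast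
  have finA: "finite A" and finX: "finite X" using A X finite_subV by auto
  have "2 \<le> a div 2" using ba b4 by simp
  then obtain t where t: "card A = Suc (Suc t)" using A(2) by (metis Suc_1 le_Suc_ex add_Suc_right add.commute plus_1_eq_Suc add_2_eq_Suc)
  then obtain u where u: "u \<in> A" by (metis card.empty ex_in_conv Zero_not_Suc)
  have cA: "card (A - {u}) = Suc t" using t u by simp
  then obtain u' where u': "u' \<in> A - {u}" by (metis card.empty ex_in_conv Zero_not_Suc)
  have adjX: "adj v z" "adj z v" if "v \<in> A" "z \<in> X" for v z
    using X(2) that adj_sym by (auto simp: joined_def)
  have q: "gpath (rev R @ [u] @ R')"
    unfolding gpath_append using R u adjX by (auto simp: last_rev)
  have qV: "set (rev R @ [u] @ R') \<subseteq> V" "b \<le> length (rev R @ [u] @ R')" using R u A b4 by auto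
  let ?Y = "X - ({x, y, x', y'} \<union> set R \<union> set R')"
  have "card ({x, y, x', y'} \<union> set R \<union> set R') \<le> 4 + length R + length R'"
  proof -
    have "card {x, y, x', y'} \<le> 4" using card_length[of "[x, y, x', y']"] by simp
    moreover have "card ({x, y, x', y'} \<union> set R \<union> set R') \<le> card {x, y, x', y'} + card (set R) + card (set R')"
      by (meson add_le_mono card_Un_le le_refl le_trans)
    ultimately show ?thesis using card_length[of R] card_length[of R'] by linarith
  qed
  moreover have "card X - card ({x, y, x', y'} \<union> set R \<union> set R') \<le> card ?Y"
    by (simp add: diff_card_le_card_Diff)
  ultimately have cY: "t \<le> card ?Y" using X(3) R(10) t A(2) ba b4 by linarith
  have "\<exists>r. gpath r \<and> set r \<subseteq> set [y, x] \<union> set [x', y'] \<union> (A - {u}) \<union> ?Y \<and>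
      length r = length [y, x] + length [x', y'] + 2 * t + 1"
  proof (rule link_path[OF _ cA u'])
    show "gpath [y, x]" using xy adj_sym by (intro gpath_edge) blast
    show "gpath [x', y']" using xy' by (intro gpath_edge)
    show "joined (A - {u}) ?Y" by (rule joined_mono[OF X(2)]) auto
    show "(A - {u}) \<inter> (set [y, x] \<union> set [x', y']) = {}" using xy xy' AX by auto
    show "adj (last [y, x]) u'" using adjX u' xy by simp
    show "adj v (hd [x', y'])" if "v \<in> A - {u}" for v using adjX that xy' by simp
    show "set [y, x] \<inter> set [x', y'] = {}" using dis by auto
    show "t \<le> card ?Y" by (rule cY)
  qed (use finA finX in auto)
  then obtain r where r: "gpath r" "set r \<subseteq> set [y, x] \<union> set [x', y'] \<union> (A - {u}) \<union> ?Y"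
      "length r = length [y, x] + length [x', y'] + 2 * t + 1" by blast
  have "set r \<subseteq> V" using r(2) xy xy' X A by auto
  moreover have "set r \<inter> set (rev R @ [u] @ R') = {}"
  proof -
    have "u \<notin> set [y, x] \<union> set [x', y'] \<union> (A - {u}) \<union> ?Y" using u xy xy' AX by auto
    moreover have "(set [y, x] \<union> set [x', y'] \<union> (A - {u}) \<union> ?Y) \<inter> (set R \<union> set R') = {}"
      using dis(2) R(7,8) by auto
    ultimately show ?thesis using r(2) by auto
  qed
  moreover have "a \<le> length r" using r(3) t A(2) by simp
  ultimately show False using F_free[OF r(1) q _ qV(1) _ _ qV(2)] by blast
qed

text \<open>\<open>A\<close> has to be enlarged by b div 2 - 1 vertices. They come from a second
  pigeonhole over a set \<open>P\<close> of at most a vertices that contains all neighbours in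
  \<open>S - A\<close> of most vertices of \<open>X\<close>.\<close>

lemma joined_k_set:
  assumes SV: "S \<subseteq> V" and degS: "\<And>x. x \<in> S \<Longrightarrow> k \<le> card (nb S x)"
    and A: "A \<subseteq> S" "card A = a div 2" and X: "X \<subseteq> S" "joined A X"
    and cX: "5 * a * (a choose (a div 2)) \<le> card X"
  obtains U X' where "U \<subseteq> V" "card U = k" "X' \<subseteq> V" "joined U X'" "4 * a \<le> card X'"
proof -
  let ?C = "a choose (a div 2)"
  have C1: "1 \<le> ?C" by (simp add: Suc_le_eq)
  then have "5 * a * 1 \<le> 5 * a * ?C" by (intro mult_le_mono2)
  then have cX5: "5 * a \<le> card X" using cX by linarith
  have AX: "A \<inter> X = {}" using X joined_disjoint by blast
  show thesis
  proof (cases "b < 4")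
    case True
    then have "b div 2 = 1" using b2 by auto
    then have "card A = k" using A by (simp add: k_def)
    then show thesis using that[of A X] A X SV cX5 by auto
  next
    case b4: False
    \<comment> \<open>d is the number of vertices still missing. It is also a lower bound for the
      degrees in \<open>H\<close>, since \<open>A\<close> accounts for at most a div 2 of at least k
      neighbours.\<close>
    define d where "d = b div 2 - 1"
    have bd: "2 * d + 2 \<le> b" "b \<le> 2 * d + 3" "1 \<le> d" "k = a div 2 + d"
      using b4 unfolding d_def k_def by auto
    define H where "H = S - A"
    have finS: "finite S" using SV finite_subV by blast
    have finH: "finite H" and HV: "H \<subseteq> V - A" and XH: "X \<subseteq> H"
      using finS SV X AX by (auto simp: H_def)
    have AV: "A \<subseteq> V" and XV: "X \<subseteq> V" using A X SV by auto
    have "path_free b (V - A)"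
      by (rule path_free_Diff[OF AV A(2) XV X(2)]) (use cX5 ba in linarith)
    then have free: "path_free b H" using path_free_subset HV by blast
    have deg: "d \<le> card (nb H x)" if "x \<in> H" for x
    proof -
      have "nb S x \<subseteq> nb H x \<union> A" by (auto simp: nb_def H_def)
      then have "card (nb S x) \<le> card (nb H x \<union> A)" using finH A finS by (intro card_mono) (auto intro: finite_subset)
      also have "\<dots> \<le> card (nb H x) + card A" by (rule card_Un_le)
      finally have "k \<le> card (nb H x) + a div 2" using degS[of x] that A(2) by (auto simp: H_def)
      then show ?thesis using bd by simp
    qed
    have "b \<le> card X" using cX5 ba by linarith
    then obtain R R' where R: "gpath R" "gpath R'" "R \<noteq> []" "R' \<noteq> []" "hd R \<in> X" "hd R' \<in> X"
      "set R \<subseteq> H" "set R' \<subseteq> H" "set R \<inter> set R' = {}" "length R + length R' = b - 1"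
      using two_paths_from_set[OF finH XH free _ deg bd(1-3)] by blast
    define Q where "Q = set R \<union> set R'"
    have QH: "Q \<subseteq> H" using R by (auto simp: Q_def)
    have cQ: "card Q \<le> b - 1"
      using card_Un_le[of "set R" "set R'"] card_length[of R] card_length[of R'] R(10) unfolding Q_def by linarith
    \<comment> \<open>If some edge from \<open>X\<close> avoids \<open>Q\<close>, then
      \<open>Y\<close> consists of its two ends: an edge from another vertex of \<open>X\<close>
      leaving \<open>Q\<close> and \<open>Y\<close> would be a second disjoint one.\<close>
    have "\<exists>Y. finite Y \<and> card Y \<le> 2 \<and> Y \<subseteq> H \<and> (\<forall>x\<in>X - (Q \<union> Y). nb H x \<subseteq> Q \<union> Y)"
    proof (cases "\<exists>x\<in>X - Q. \<exists>y\<in>H - Q. adj x y")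
      case True
      then obtain x y where xy: "x \<in> X - Q" "y \<in> H - Q" "adj x y" by blast
      have "nb H x' \<subseteq> Q \<union> {x, y}" if x': "x' \<in> X - (Q \<union> {x, y})" for x'
      proof
        fix y' assume y': "y' \<in> nb H x'"
        then have adj': "adj x' y'" "y' \<in> H" by (auto simp: nb_def)
        have "x \<noteq> y" "x' \<noteq> y'" using xy adj' by auto
        show "y' \<in> Q \<union> {x, y}"
        proof (rule ccontr)
          assume "y' \<notin> Q \<union> {x, y}"
          then have dis: "distinct [x, y, x', y']" "{x, y, x', y'} \<inter> (set R \<union> set R') = {}"
            using x' xy \<open>x \<noteq> y\<close> \<open>x' \<noteq> y'\<close> by (auto simp: Q_def)
          have sub: "set R \<subseteq> V - A" "set R' \<subseteq> V - A" "x \<in> X" "y \<in> V - A" "x' \<in> X" "y' \<in> V - A"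
            using R(7,8) HV xy x' adj' by blast+
          have c: "3 * a \<le> card X" "4 \<le> b" using cX5 b4 by simp_all
          show False
            by (rule no_two_edges_off_paths[OF AV A(2) XV X(2) c(1) R(1-6) sub(1,2) R(9,10) c(2)
                  sub(3,4) xy(3) sub(5,6) adj'(1) dis])
        qed
      qed
      moreover have "card {x, y} \<le> 2" "{x, y} \<subseteq> H"
        using xy XH by (auto simp: card_insert_if)
      ultimately show ?thesis by (intro exI[of _ "{x, y}"]) simp
    next
      case False
      then show ?thesis by (intro exI[of _ "{}"]) (auto simp: nb_def)
    qed
    then obtain Y where Y: "finite Y" "card Y \<le> 2" "Y \<subseteq> H"
      and nbY: "\<And>x. x \<in> X - (Q \<union> Y) \<Longrightarrow> nb H x \<subseteq> Q \<union> Y" by blast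
    define P where "P = Q \<union> Y"
    have finP: "finite P" using Y by (simp add: P_def Q_def)
    have "card P \<le> card Q + card Y" unfolding P_def by (rule card_Un_le)
    \<comment> \<open>At most b - 1 vertices on the two paths and two in \<open>Y\<close>, so at
      most b + 1 in all.\<close>
    then have cP: "card P \<le> a" using cQ Y(2) ba b2 by linarith
    define X1 where "X1 = X - P"
    have "card X - card P \<le> card X1" unfolding X1_def using finP by (simp add: diff_card_le_card_Diff)
    moreover have "a * 1 \<le> a * ?C" using C1 by (intro mult_le_mono2)
    ultimately have cX1: "4 * a * ?C \<le> card X1" using cX cP unfolding mult.assoc by linarith
    have "0 < 4 * a * ?C" using C1 ba by simp
    then have "card X1 \<noteq> 0" using cX1 by linarith
    then have X1: "X1 \<noteq> {}" "finite X1" by (auto simp: card_eq_0_iff)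
    have "d \<le> card (nb P x)" if "x \<in> X1" for x
    proof -
      have "nb H x \<subseteq> nb P x" using nbY[of x] that by (auto simp: X1_def P_def nb_def)
      then have "card (nb H x) \<le> card (nb P x)" using finP by (simp add: card_mono)
      then show ?thesis using deg[of x] that XH by (auto simp: X1_def)
    qed
    then obtain B X2 where B: "B \<subseteq> P" "card B = d" "X2 \<subseteq> X1" "joined B X2"
      and c2: "card X1 \<le> (card P choose d) * card X2"
      using common_neighbours[OF X1(2) finP X1(1)] by metis
    \<comment> \<open>The central binomial coefficient also bounds the number of classes in this
      second pigeonhole.\<close>
    have "card P choose d \<le> a choose d" using cP by (rule binomial_right_mono)
    also have "\<dots> \<le> ?C" by (rule binomial_maximum)
    finally have "(card P choose d) * card X2 \<le> ?C * card X2" by (rule mult_le_mono1)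
    moreover have "?C * (4 * a) = 4 * a * ?C" by (rule mult.commute)
    ultimately have "?C * (4 * a) \<le> ?C * card X2" using cX1 c2 by linarith
    then have cX2: "4 * a \<le> card X2" using C1 by simp
    have PH: "P \<subseteq> H" using QH Y by (simp add: P_def)
    have "A \<inter> B = {}" using B(1) PH by (auto simp: H_def)
    then have "card (A \<union> B) = k"
      using A B finP bd finS by (auto simp: card_Un_disjoint finite_subset)
    moreover have "A \<union> B \<subseteq> V" "X2 \<subseteq> V" using B PH HV AV XV by (auto simp: X1_def)
    moreover have "joined (A \<union> B) X2"
      using B X by (auto simp: joined_def X1_def)
    ultimately show thesis using that cX2 by blast
  qed
qed

end

section \<open>Counting edges off the joined set\<close>

locale two_path_free_joined = two_path_free +
  fixes U X :: "'a set"
  assumes UV: "U \<subseteq> V" and cardU: "card U = k" and XV: "X \<subseteq> V" and UX: "joined U X"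
    and cardX: "4 * a \<le> card X"
begin

abbreviation "W \<equiv> V - U"

definition "nonisolated = {w \<in> W. nb W w \<noteq> {}}"
definition "attached = {w \<in> nonisolated. nb U w \<noteq> {}}"

lemma nonisolated_subset: "nonisolated \<subseteq> W" and attached_subset: "attached \<subseteq> nonisolated"
  by (auto simp: nonisolated_def attached_def)

lemma finW [simp]: "finite W" "finite U" "finite nonisolated" "finite attached"
  using finV finite_subV[OF UV] by (auto simp: nonisolated_def attached_def)

lemma W_path_free: "path_free b W"
proof -
  obtain T where T: "T \<subseteq> U" "card T = a div 2"
    using obtain_subset_with_card_n[of "a div 2" U] cardU k_ge(2) by auto
  have "path_free b (V - T)"
    by (rule path_free_Diff[of T X]) (use T UV XV UX cardX ba joined_mono in auto)
  then show ?thesis using path_free_subset T by (meson Diff_mono order_refl)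
qed

text \<open>Starting with the edge yw instead of a vertex of \<open>X\<close> saves one vertex of
  \<open>U\<close> on the path of even order, so that k vertices of \<open>U\<close> suffice for
  both paths. For b = 2 the edge itself is already the short path.\<close>

lemma no_attached_edge:
  assumes "even a \<or> even b" "w \<in> W" "y \<in> W" "adj w y" "u \<in> U" "adj w u"
  shows False
proof -
  have p: "gpath [y, w]" using adj_sym assms by (intro gpath_edge) blast
  have pW: "set [y, w] \<subseteq> W" "adj (last [y, w]) u" using assms by auto
  note no = no_half_and_plain_path[OF UV XV UX p _ pW(1) assms(5) pW(2)]
  show False
  proof (cases "even a")
    case True
    have t: "1 \<le> a div 2 - 1" "1 \<le> b div 2" "a div 2 - 1 + b div 2 \<le> card U"
      "a \<le> 2 + 2 * (a div 2 - 1)" "b \<le> 2 * (b div 2) + 1"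
      using even_two_times_div_two[OF True] halves ba b2 unfolding cardU by linarith+
    have c: "2 + 1 + (a div 2 - 1) + b div 2 \<le> card X" using cardX ba b2 by linarith
    show False using no[of "a div 2 - 1" "b div 2"] t c by simp
  next
    case False
    then have ev: "even b" using assms by blast
    show False
    proof (cases "b = 2")
      case True
      then show False using W_path_free p assms by (auto simp: path_free_def)
    next
      case b: False
      have t: "1 \<le> b div 2 - 1" "1 \<le> a div 2" "b div 2 - 1 + a div 2 \<le> card U"
        "b \<le> 2 + 2 * (b div 2 - 1)" "a \<le> 2 * (a div 2) + 1"
        using even_two_times_div_two[OF ev] b halves ba b2 unfolding cardU by linarith+
      have c: "2 + 1 + (b div 2 - 1) + a div 2 \<le> card X" using cardX ba b2 by linarith
      show False using no[of "b div 2 - 1" "a div 2"] t c by simp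
    qed
  qed
qed

text \<open>For odd a, saving a vertex of \<open>U\<close> takes three vertices of \<open>W\<close>
  in place of one vertex of \<open>X\<close>: a = 3 + 2(a div 2 - 1). They come from a path on three
  vertices, or from two edges placed at the two ends of the path.\<close>

lemma odd_sizes:
  assumes "odd a" "odd b"
  shows "1 \<le> a div 2 - 1" "1 \<le> b div 2" "a div 2 - 1 + b div 2 \<le> card U"
    "a \<le> 3 + 2 * (a div 2 - 1)" "b \<le> 2 * (b div 2) + 1" "4 + (a div 2 - 1) + b div 2 \<le> card X"
proof -
  show "1 \<le> a div 2 - 1" "1 \<le> b div 2" "a div 2 - 1 + b div 2 \<le> card U"
    "a \<le> 3 + 2 * (a div 2 - 1)" "b \<le> 2 * (b div 2) + 1"
    using odd_two_times_div_two_succ[OF assms(1)] odd_two_times_div_two_succ[OF assms(2)] halves ba b2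
    unfolding cardU by linarith+
  show "4 + (a div 2 - 1) + b div 2 \<le> card X" using cardX ba b2 by linarith
qed

lemma no_attached_P3:
  assumes odd: "odd a" "odd b" and "w \<in> W" "y \<in> W" "z \<in> W" "adj w y" "adj y z" "z \<noteq> w" "u \<in> U" "adj w u"
  shows False
proof -
  have p: "gpath [z, y, w]" using adj_sym assms by (intro gpath_P3) blast+
  have pW: "set [z, y, w] \<subseteq> W" "adj (last [z, y, w]) u" using assms by auto
  show False
    using no_half_and_plain_path[OF UV XV UX p _ pW(1) assms(9) pW(2), of "a div 2 - 1" "b div 2"]
      odd_sizes[OF odd] by simp
qed

lemma no_two_attached_edges:
  assumes odd: "odd a" "odd b" and "w \<in> W" "y \<in> W" "adj w y" "u \<in> U" "adj w u"
    and "x0 \<in> W" "y0 \<in> W" "adj x0 y0" "\<And>v. v \<in> U \<Longrightarrow> adj v x0" "{w, y} \<inter> {x0, y0} = {}"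
  shows False
proof -
  have p: "gpath [y, w]" using adj_sym assms by (intro gpath_edge) blast
  have pW: "set [y, w] \<subseteq> W" "adj (last [y, w]) u" using assms by auto
  have q: "gpath [x0, y0]" using assms(10) by (rule gpath_edge)
  have qW: "set [x0, y0] \<subseteq> W" "\<And>v. v \<in> U \<Longrightarrow> adj v (hd [x0, y0])" "set [y, w] \<inter> set [x0, y0] = {}"
    using assms by auto
  show False
    using no_link_and_plain_path[OF UV XV UX p _ pW(1) q _ qW(1,3) assms(6) pW(2) qW(2), of "a div 2 - 1" "b div 2"]
      odd_sizes[OF odd] by simp
qed

lemma card_nb_U_le: "card (nb U w) \<le> k"
  using cardU nb_subset[of U w] by (metis card_mono finW(2))

lemma card_nb_U_eq: "card (nb U w) = k \<longleftrightarrow> (\<forall>u\<in>U. adj w u)"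
proof -
  have "card (nb U w) = k \<longleftrightarrow> nb U w = U"
    using cardU nb_subset[of U w] by (metis card_subset_eq finW(2))
  then show ?thesis by (auto simp: nb_def)
qed

lemma edges_in_nonisolated: "edges_in W = edges_in nonisolated"
proof (intro equalityI subsetI)
  fix e assume e: "e \<in> edges_in W"
  then obtain x y where xy: "e = {x, y}" "x \<noteq> y" using edge_pair unfolding edges_in_def by blast
  then have "adj x y" "adj y x" "x \<in> W" "y \<in> W" using e by (auto simp: edges_in_def adj_def insert_commute)
  then have "x \<in> nonisolated" "y \<in> nonisolated" by (auto simp: nonisolated_def nb_def)
  then show "e \<in> edges_in nonisolated" using e xy by (auto simp: edges_in_def)
qed (auto simp: edges_in_def nonisolated_def)

section \<open>Bounding the number of edges that meet \<open>W\<close>\<close>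

definition weight where "weight = card (edges_in W) + (\<Sum>w\<in>W. card (nb U w))"

lemma card_edges_in_V: "card (edges_in V) = card (edges_in U) + weight"
proof -
  have "U \<union> W = V" using UV by blast
  then show ?thesis using card_edges_in_Un[of U W] by (simp add: weight_def)
qed

text \<open>Vertices of \<open>nonisolated - attached\<close> send no edge to \<open>U\<close>, so
  their sum of neighbours in \<open>U\<close> drops out.\<close>

lemma weight_split:
  "weight = card (edges_in attached) + card (edges_in (nonisolated - attached)) + (\<Sum>y\<in>nonisolated - attached. card (nb attached y))
    + (\<Sum>w\<in>W - nonisolated. card (nb U w)) + (\<Sum>w\<in>attached. card (nb U w))"
proof -
  have W23: "attached \<union> (nonisolated - attached) = nonisolated" by (auto simp: attached_def)
  have e: "card (edges_in W) = card (edges_in attached) + card (edges_in (nonisolated - attached)) + (\<Sum>y\<in>nonisolated - attached. card (nb attached y))"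
    using card_edges_in_Un[of attached "nonisolated - attached"] unfolding W23 edges_in_nonisolated by simp
  have "(\<Sum>w\<in>nonisolated - attached. card (nb U w)) = 0" by (simp add: attached_def)
  then have "(\<Sum>w\<in>nonisolated. card (nb U w)) = (\<Sum>w\<in>attached. card (nb U w))"
    using sum.subset_diff[of attached nonisolated "\<lambda>w. card (nb U w)"] by (auto simp: attached_def)
  moreover have "(\<Sum>w\<in>W. card (nb U w)) = (\<Sum>w\<in>W - nonisolated. card (nb U w)) + (\<Sum>w\<in>nonisolated. card (nb U w))"
    using sum.subset_diff[of nonisolated W "\<lambda>w. card (nb U w)"] by (auto simp: nonisolated_def)
  ultimately show ?thesis using e by (simp add: weight_def)
qed

lemma card_W_split: "card W = card (W - nonisolated) + card attached + card (nonisolated - attached)"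
proof -
  have "card W = card (W - nonisolated) + card nonisolated"
    using card_Diff_subset[of nonisolated W] card_mono[of W nonisolated] nonisolated_subset by simp
  moreover have "card nonisolated = card attached + card (nonisolated - attached)"
    using card_Diff_subset[of attached nonisolated] card_mono[of nonisolated attached] attached_subset by simp
  ultimately show ?thesis by simp
qed

lemma unattached_edges: "2 * card (edges_in (nonisolated - attached)) \<le> (b - 2) * card (nonisolated - attached)"
proof (rule Erdos_Gallai)
  show "path_free b (nonisolated - attached)" by (rule path_free_subset[OF W_path_free]) (use nonisolated_subset in blast)
qed simp

lemma isolated_weight: "(\<Sum>w\<in>W - nonisolated. card (nb U w)) \<le> k * card (W - nonisolated)"
  using sum_bounded_above[of "W - nonisolated" "\<lambda>w. card (nb U w)" k] card_nb_U_le by (simp add: mult.commute)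

lemma isolated_weight_eq:
  assumes "(\<Sum>w\<in>W - nonisolated. card (nb U w)) = k * card (W - nonisolated)" "w \<in> W - nonisolated" "u \<in> U"
  shows "adj w u"
proof -
  have "(\<Sum>w\<in>W - nonisolated. card (nb U w)) = (\<Sum>w\<in>W - nonisolated. k)" using assms by simp
  then have "card (nb U w) = k"
    using sum_mono_inv[of "\<lambda>w. card (nb U w)" "W - nonisolated" "\<lambda>_. k" w] card_nb_U_le assms by auto
  then show ?thesis using card_nb_U_eq assms by blast
qed

text \<open>By Erdos-Gallai \<open>nonisolated - attached\<close> has at most (b - 2)/2 edges per
  vertex, fewer than k, while a vertex isolated in \<open>W\<close> contributes at most k. So the
  bound is reached only when \<open>nonisolated - attached\<close> is empty and all isolated
  vertices are joined to \<open>U\<close>.\<close>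

lemma unattached_strict:
  assumes "card (edges_in (nonisolated - attached)) + (\<Sum>w\<in>W - nonisolated. card (nb U w)) \<ge> k * (card (W - nonisolated) + card (nonisolated - attached))"
  shows "card (edges_in (nonisolated - attached)) + (\<Sum>w\<in>W - nonisolated. card (nb U w)) = k * (card (W - nonisolated) + card (nonisolated - attached))"
    and "nonisolated = attached" and "\<And>w u. w \<in> W - nonisolated \<Longrightarrow> u \<in> U \<Longrightarrow> adj w u"
proof -
  let ?c = "card (nonisolated - attached)"
  have "(b - 2) * ?c + ?c \<le> k * ?c"
  proof -
    have "(b - 2) * ?c + ?c = Suc (b - 2) * ?c" by simp
    also have "\<dots> \<le> k * ?c" using k_ge(1) b2 by (intro mult_le_mono1) linarith
    finally show ?thesis .
  qed
  then have c0: "?c = 0" using assms isolated_weight unattached_edges unfolding distrib_left by linarith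
  then have "nonisolated - attached = {}" by simp
  then show eq: "nonisolated = attached" by (auto simp: attached_def)
  have "(\<Sum>w\<in>W - nonisolated. card (nb U w)) = k * card (W - nonisolated)"
    using assms isolated_weight eq by simp
  then show "\<And>w u. w \<in> W - nonisolated \<Longrightarrow> u \<in> U \<Longrightarrow> adj w u"
    "card (edges_in (nonisolated - attached)) + (\<Sum>w\<in>W - nonisolated. card (nb U w)) = k * (card (W - nonisolated) + card (nonisolated - attached))"
    using isolated_weight_eq eq by simp_all
qed


text \<open>Reaching the bound already implies equality, so it is never exceeded.\<close>

lemma unattached_le:
  "card (edges_in (nonisolated - attached)) + (\<Sum>w\<in>W - nonisolated. card (nb U w)) \<le> k * (card (W - nonisolated) + card (nonisolated - attached))"
  using unattached_strict(1) by linarith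

lemma attachedE:
  assumes "w \<in> attached"
  obtains y u where "w \<in> W" "y \<in> W" "adj w y" "u \<in> U" "adj w u"
  using assms by (auto simp: attached_def nonisolated_def nb_def)

lemma no_edge_isolated: "w \<in> W - nonisolated \<Longrightarrow> w' \<in> W \<Longrightarrow> \<not> adj w w'"
  by (auto simp: nonisolated_def nb_def)

lemma weight_not_both_odd:
  assumes "even a \<or> even b"
  shows "weight \<le> k * card W"
    and "weight = k * card W \<Longrightarrow> (\<forall>w\<in>W. \<forall>u\<in>U. adj w u) \<and> (\<forall>w\<in>W. \<forall>w'\<in>W. \<not> adj w w')"
proof -
  have attached: "attached = {}" using no_attached_edge[OF assms] attachedE by (metis ex_in_conv)
  have nb0: "nb {} y = {}" for y by (simp add: nb_def)
  have w: "weight = card (edges_in (nonisolated - attached)) + (\<Sum>w\<in>W - nonisolated. card (nb U w))"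
    unfolding weight_split by (simp add: attached nb0)
  have c: "card W = card (W - nonisolated) + card (nonisolated - attached)" using card_W_split attached by simp
  show "weight \<le> k * card W" unfolding w c by (rule unattached_le)
  assume "weight = k * card W"
  then have ge: "k * (card (W - nonisolated) + card (nonisolated - attached))
      \<le> card (edges_in (nonisolated - attached)) + (\<Sum>w\<in>W - nonisolated. card (nb U w))"
    unfolding w c by simp
  have "nonisolated = {}" using unattached_strict(2)[OF ge] attached by simp
  then show "(\<forall>w\<in>W. \<forall>u\<in>U. adj w u) \<and> (\<forall>w\<in>W. \<forall>w'\<in>W. \<not> adj w w')"
    using unattached_strict(3)[OF ge] no_edge_isolated by simp
qed

text \<open>An edge of \<open>W\<close> completely joined to \<open>U\<close> is a component of
  \<open>W\<close>, and a disjoint attached edge could be linked to it through \<open>U\<close>. So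
  \<open>attached\<close> is just this edge, which contributes the extra 1.\<close>

lemma weight_full_edge:
  assumes odd: "odd a" "odd b" and xy: "x0 \<in> W" "y0 \<in> W" "adj x0 y0"
    and full: "\<forall>u\<in>U. adj x0 u \<and> adj y0 u"
  shows "weight \<le> k * card W + 1"
    and "weight = k * card W + 1 \<Longrightarrow> (\<forall>w\<in>W. \<forall>u\<in>U. adj w u) \<and>
      (\<forall>w\<in>W. \<forall>w'\<in>W. adj w w' \<longleftrightarrow> {w, w'} = {x0, y0})"
proof -
  have ne: "x0 \<noteq> y0" using xy by auto
  have "U \<noteq> {}" using cardU k_ge(3) by auto
  then obtain u0 where u0: "u0 \<in> U" by blast
  have nx: "w = y0" if "w \<in> W" "adj x0 w" for w
    using no_attached_P3[OF odd xy(2,1) that(1) adj_sym[OF xy(3)] that(2) _ u0] full u0 by blast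
  have ny: "w = x0" if "w \<in> W" "adj y0 w" for w
    using no_attached_P3[OF odd xy(1,2) that(1) xy(3) that(2) _ u0] full u0 by blast
  have "w \<in> {x0, y0}" if "w \<in> attached" for w
  proof (rule ccontr)
    assume w: "w \<notin> {x0, y0}"
    obtain y u where yu: "w \<in> W" "y \<in> W" "adj w y" "u \<in> U" "adj w u" using attachedE[OF \<open>w \<in> attached\<close>] by blast
    have "y \<notin> {x0, y0}" using nx[of w] ny[of w] yu w adj_sym by blast
    then show False
      using no_two_attached_edges[OF odd yu xy] w full adj_sym by blast
  qed
  moreover have "x0 \<in> attached" "y0 \<in> attached"
    using xy u0 full adj_sym by (auto simp: attached_def nonisolated_def nb_def)
  ultimately have attached: "attached = {x0, y0}" by blast
  then have cW3: "card attached = 2" using ne by simp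
  then have e1: "card (edges_in attached) \<le> 1" using card_edges_in_complete_le[of attached] by simp
  have "nb attached y = {}" if "y \<in> nonisolated - attached" for y
    using that nx[of y] ny[of y] nonisolated_subset adj_sym unfolding attached nb_def by blast
  then have s0: "(\<Sum>y\<in>nonisolated - attached. card (nb attached y)) = 0" by simp
  have s1: "(\<Sum>w\<in>attached. card (nb U w)) \<le> 2 * k"
    using sum_bounded_above[of attached "\<lambda>w. card (nb U w)" k] card_nb_U_le cW3 by simp
  define R where "R = card (edges_in (nonisolated - attached)) + (\<Sum>w\<in>W - nonisolated. card (nb U w))"
  define c where "c = card (W - nonisolated) + card (nonisolated - attached)"
  have R: "R \<le> k * c" unfolding R_def c_def by (rule unattached_le)
  have w: "weight \<le> 1 + R + 2 * k" unfolding weight_split R_def using e1 s0 s1 by simp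
  have cW: "k * card W = k * c + 2 * k" unfolding card_W_split c_def cW3 by (simp add: algebra_simps)
  show "weight \<le> k * card W + 1" using w R cW by linarith
  assume "weight = k * card W + 1"
  then have "k * c \<le> R" using w cW by linarith
  then have ge: "k * (card (W - nonisolated) + card (nonisolated - attached))
      \<le> card (edges_in (nonisolated - attached)) + (\<Sum>w\<in>W - nonisolated. card (nb U w))" unfolding R_def c_def .
  have nonisolated: "nonisolated = {x0, y0}" using unattached_strict(2)[OF ge] attached by simp
  have "adj w u" if "w \<in> W" "u \<in> U" for w u
  proof (cases "w \<in> nonisolated")
    case True
    then show ?thesis using nonisolated full that by auto
  next
    case False
    then show ?thesis using unattached_strict(3)[OF ge, of w u] that by simp
  qed
  moreover have "adj w w' \<longleftrightarrow> {w, w'} = {x0, y0}" if "w \<in> W" "w' \<in> W" for w w'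
  proof
    assume "adj w w'"
    then have "w \<in> nonisolated" using no_edge_isolated that by blast
    then have "w = x0 \<or> w = y0" using nonisolated by simp
    then show "{w, w'} = {x0, y0}" using nx[OF that(2)] ny[OF that(2)] \<open>adj w w'\<close> by auto
  next
    assume "{w, w'} = {x0, y0}"
    then show "adj w w'" using xy by (simp add: adj_def)
  qed
  ultimately show "(\<forall>w\<in>W. \<forall>u\<in>U. adj w u) \<and> (\<forall>w\<in>W. \<forall>w'\<in>W. adj w w' \<longleftrightarrow> {w, w'} = {x0, y0})"
    by blast
qed

text \<open>Each edge inside \<open>attached\<close> is an isolated edge of \<open>W\<close>, so choosing an endpoint that misses a vertex
  of \<open>U\<close> is injective on these edges, and the missing edge pays for the edge.\<close>

lemma weight_no_full_edge:
  assumes odd: "odd a" "odd b"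
    and nofull: "\<And>x y. x \<in> W \<Longrightarrow> y \<in> W \<Longrightarrow> adj x y \<Longrightarrow> card (nb U x) < k \<or> card (nb U y) < k"
  shows "weight \<le> k * card W"
proof -
  have noP3: False if w: "w \<in> attached" and "y \<in> W" "z \<in> W" "adj w y" "adj y z" "z \<noteq> w" for w y z
  proof -
    obtain y' u where "w \<in> W" "u \<in> U" "adj w u" using attachedE[OF w] by blast
    then show False using no_attached_P3[OF odd, of w y z u] that by blast
  qed
  have W3W: "attached \<subseteq> W" using nonisolated_subset attached_subset by blast
  define N where "N = {w \<in> attached. card (nb U w) < k}"
  have "\<exists>w. w \<in> e \<and> w \<in> N" if e: "e \<in> edges_in attached" for e
  proof -
    obtain x y where xy: "e = {x, y}" "adj x y" "x \<in> attached" "y \<in> attached"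
      using edges_inE[OF e] by metis
    then have "card (nb U x) < k \<or> card (nb U y) < k" using nofull[of x y] W3W by blast
    then show ?thesis using xy unfolding N_def by auto
  qed
  then obtain g where g: "\<And>e. e \<in> edges_in attached \<Longrightarrow> g e \<in> e \<and> g e \<in> N" by metis
  have "inj_on g (edges_in attached)"
  proof (rule inj_onI)
    fix e e' assume e: "e \<in> edges_in attached" and e': "e' \<in> edges_in attached" and eq: "g e = g e'"
    have other: "\<exists>x. f = {g f, x} \<and> adj (g f) x \<and> x \<in> attached" if f: "f \<in> edges_in attached" for f
    proof -
      obtain x y where xy: "f = {x, y}" "adj x y" "x \<in> attached" "y \<in> attached"
        using edges_inE[OF f] by metis
      then have "g f = x \<or> g f = y" using g[OF f] by blast
      then show ?thesis using xy adj_sym by (auto simp: insert_commute)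
    qed
    obtain x where x: "e = {g e, x}" "adj (g e) x" "x \<in> attached" using other[OF e] by blast
    obtain x' where x': "e' = {g e, x'}" "adj (g e) x'" "x' \<in> attached" using other[OF e'] eq by metis
    have "g e \<in> W" "x' \<in> W" using g[OF e] x' W3W by (auto simp: N_def)
    then have "x' = x" using noP3[OF x(3), of "g e" x'] x x' adj_sym by blast
    then show "e = e'" using x x' by simp
  qed
  then have "card (edges_in attached) \<le> card N"
    using g by (intro card_inj_on_le[of g]) (auto simp: N_def)
  moreover have "card N = (\<Sum>w\<in>attached. if card (nb U w) < k then 1 else 0)"
    unfolding N_def by (simp add: sum.If_cases Collect_conj_eq)
  ultimately have "card (edges_in attached) + (\<Sum>w\<in>attached. card (nb U w))
      \<le> (\<Sum>w\<in>attached. (if card (nb U w) < k then 1 else 0) + card (nb U w))"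
    by (simp add: sum.distrib)
  also have "\<dots> \<le> (\<Sum>w\<in>attached. k)" by (rule sum_mono) (use card_nb_U_le in auto)
  finally have e3: "card (edges_in attached) + (\<Sum>w\<in>attached. card (nb U w)) \<le> k * card attached"
    by (simp add: mult.commute)
  \<comment> \<open>Two attached neighbours of \<open>y\<close> would form with it an attached path
    on three vertices.\<close>
  have "card (nb attached y) \<le> 1" if y: "y \<in> nonisolated - attached" for y
  proof -
    have "w = w'" if "w \<in> nb attached y" "w' \<in> nb attached y" for w w'
      using noP3[of w y w'] that y W3W nonisolated_subset adj_sym by (auto simp: nb_def)
    then show ?thesis by (metis card_le_Suc0_iff_eq finite_nb finW(4) One_nat_def)
  qed
  then have s4: "(\<Sum>y\<in>nonisolated - attached. card (nb attached y)) \<le> card (nonisolated - attached)"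
    using sum_mono[of "nonisolated - attached" "\<lambda>y. card (nb attached y)" "\<lambda>_. 1"] by simp
  define c where "c = card (nonisolated - attached)"
  \<comment> \<open>A vertex of \<open>nonisolated - attached\<close> accounts for at most (b - 2)/2
    edges among these vertices and one edge to \<open>attached\<close>, together b/2, which is at
    most k.\<close>
  have "(b - 2) * c + 2 * c = b * c" using b2 by (metis distrib_right le_add_diff_inverse2)
  also have "\<dots> \<le> 2 * k * c" using k_ge(5) by (rule mult_le_mono1)
  finally have bc: "(b - 2) * c + 2 * c \<le> 2 * (k * c)" by simp
  have e4: "2 * card (edges_in (nonisolated - attached)) \<le> (b - 2) * c" using unattached_edges by (simp add: c_def)
  have "2 * weight \<le> 2 * (k * card attached) + 2 * (k * c) + 2 * (k * card (W - nonisolated))"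
  proof -
    have arith: "x + y \<le> p \<Longrightarrow> z \<le> c \<Longrightarrow> d + 2 * c \<le> 2 * q \<Longrightarrow> 2 * e \<le> d \<Longrightarrow> i \<le> r \<Longrightarrow>
      2 * (x + e + z + i + y) \<le> 2 * p + 2 * q + 2 * r" for x y z p q r d e i :: nat
      by simp
    show ?thesis unfolding weight_split by (rule arith[OF e3 s4[folded c_def] bc e4 isolated_weight])
  qed
  also have "\<dots> = 2 * (k * card W)" unfolding card_W_split c_def by (simp add: algebra_simps)
  finally show ?thesis by simp
qed

definition "extra = (if odd a \<and> odd b then 1 else 0 :: nat)"

lemma weight_le: "weight \<le> k * card W + extra"
  and weight_eq: "weight = k * card W + extra \<Longrightarrow> (\<forall>w\<in>W. \<forall>u\<in>U. adj w u) \<and>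
    (\<exists>x0\<in>W. \<exists>y0\<in>W. (odd a \<and> odd b \<longrightarrow> x0 \<noteq> y0) \<and>
      (\<forall>w\<in>W. \<forall>w'\<in>W. adj w w' \<longleftrightarrow> odd a \<and> odd b \<and> {w, w'} = {x0, y0}))"
proof -
  have "1 \<le> card X" using cardX ba by linarith
  then obtain x where "x \<in> X" by (metis card.empty ex_in_conv not_one_le_zero)
  \<comment> \<open>A dummy value for \<open>x0\<close> and \<open>y0\<close> when a and b are not
    both odd.\<close>
  then have xW: "x \<in> W" using XV joined_disjoint[OF UX] by blast
  have *: "weight \<le> k * card W + extra \<and> (weight = k * card W + extra \<longrightarrow> (\<forall>w\<in>W. \<forall>u\<in>U. adj w u) \<and>
    (\<exists>x0\<in>W. \<exists>y0\<in>W. (odd a \<and> odd b \<longrightarrow> x0 \<noteq> y0) \<and>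
      (\<forall>w\<in>W. \<forall>w'\<in>W. adj w w' \<longleftrightarrow> odd a \<and> odd b \<and> {w, w'} = {x0, y0})))"
  proof (cases "odd a \<and> odd b")
    case False
    then have ex: "extra = 0" and ev: "even a \<or> even b" by (auto simp: extra_def)
    show ?thesis using weight_not_both_odd[OF ev] False xW unfolding ex by auto
  next
    case True
    then have ex: "extra = 1" by (simp add: extra_def)
    show ?thesis
    proof (cases "\<exists>x0\<in>W. \<exists>y0\<in>W. adj x0 y0 \<and> (\<forall>u\<in>U. adj x0 u \<and> adj y0 u)")
      case full: True
      then obtain x0 y0 where xy: "x0 \<in> W" "y0 \<in> W" "adj x0 y0" "\<forall>u\<in>U. adj x0 u \<and> adj y0 u" by blast
      then have ne: "x0 \<noteq> y0" by auto
      note full = weight_full_edge[OF conjunct1[OF True] conjunct2[OF True] xy]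
      show ?thesis
      proof (intro conjI impI)
        show "weight \<le> k * card W + extra" using full(1) unfolding ex .
        assume "weight = k * card W + extra"
        then have f: "(\<forall>w\<in>W. \<forall>u\<in>U. adj w u) \<and> (\<forall>w\<in>W. \<forall>w'\<in>W. adj w w' \<longleftrightarrow> {w, w'} = {x0, y0})"
          using full(2) unfolding ex by simp
        then show "\<forall>w\<in>W. \<forall>u\<in>U. adj w u" by (rule conjunct1)
        show "\<exists>x0\<in>W. \<exists>y0\<in>W. (odd a \<and> odd b \<longrightarrow> x0 \<noteq> y0) \<and>
            (\<forall>w\<in>W. \<forall>w'\<in>W. adj w w' \<longleftrightarrow> odd a \<and> odd b \<and> {w, w'} = {x0, y0})"
          by (rule bexI[OF bexI[OF _ xy(2)] xy(1)]) (use f ne True in simp)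
      qed
    next
      case False
      have "card (nb U x) < k \<or> card (nb U y) < k" if "x \<in> W" "y \<in> W" "adj x y" for x y
      proof (rule ccontr)
        assume "\<not> ?thesis"
        then have "card (nb U x) = k" "card (nb U y) = k"
          using card_nb_U_le[of x] card_nb_U_le[of y] by auto
        then show False using False that unfolding card_nb_U_eq by blast
      qed
      then have "weight \<le> k * card W" using weight_no_full_edge True by simp
      then show ?thesis unfolding ex by simp
    qed
  qed
  show "weight \<le> k * card W + extra" using * by blast
  assume "weight = k * card W + extra"
  then show "(\<forall>w\<in>W. \<forall>u\<in>U. adj w u) \<and>
    (\<exists>x0\<in>W. \<exists>y0\<in>W. (odd a \<and> odd b \<longrightarrow> x0 \<noteq> y0) \<and>
      (\<forall>w\<in>W. \<forall>w'\<in>W. adj w w' \<longleftrightarrow> odd a \<and> odd b \<and> {w, w'} = {x0, y0}))" using * by blast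
qed

section \<open>The edge bound for the whole graph and its equality case\<close>

lemma card_W: "card W = card V - k"
  using card_Diff_subset[of U V] UV cardU by simp

lemma card_edges_le: "2 * card (edges_in V) \<le> k * (k - 1) + 2 * (k * (card V - k) + extra)"
  using card_edges_in_complete_le[of U] weight_le card_edges_in_V unfolding cardU card_W by simp

lemma card_edges_eq:
  assumes "2 * card (edges_in V) = k * (k - 1) + 2 * (k * (card V - k) + extra)"
  shows "\<exists>x0\<in>W. \<exists>y0\<in>W. (odd a \<and> odd b \<longrightarrow> x0 \<noteq> y0) \<and>
    (\<forall>x\<in>V. \<forall>y\<in>V. adj x y \<longleftrightarrow> x \<noteq> y \<and> (x \<in> U \<or> y \<in> U \<or> odd a \<and> odd b \<and> {x, y} = {x0, y0}))"
proof -
  have le: "2 * card (edges_in U) \<le> k * (k - 1)" using card_edges_in_complete_le[of U] cardU by simp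
  have arith: "2 * x \<le> p \<Longrightarrow> y \<le> q \<Longrightarrow> 2 * (x + y) = p + 2 * q \<Longrightarrow> 2 * x = p \<and> y = q" for x y p q :: nat
    by auto
  have "2 * card (edges_in U) = k * (k - 1) \<and> weight = k * card W + extra"
    by (rule arith[OF le weight_le assms[unfolded card_edges_in_V card_W[symmetric]]])
  then have eU: "2 * card (edges_in U) = card U * (card U - 1)" and w: "weight = k * card W + extra"
    unfolding cardU by simp_all
  have U: "adj x y" if "x \<in> U" "y \<in> U" "x \<noteq> y" for x y
    using card_edges_in_complete_iff[of U] eU that by simp
  note eq = weight_eq[OF w]
  have UW: "\<forall>w\<in>W. \<forall>u\<in>U. adj w u" using conjunct1[OF eq] .
  obtain x0 y0 where xy: "x0 \<in> W" "y0 \<in> W" "odd a \<and> odd b \<longrightarrow> x0 \<noteq> y0"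
    "\<forall>w\<in>W. \<forall>w'\<in>W. adj w w' \<longleftrightarrow> odd a \<and> odd b \<and> {w, w'} = {x0, y0}"
    using conjunct2[OF eq] by (elim bexE conjE)
  have "adj x y \<longleftrightarrow> x \<noteq> y \<and> (x \<in> U \<or> y \<in> U \<or> odd a \<and> odd b \<and> {x, y} = {x0, y0})"
    if "x \<in> V" "y \<in> V" for x y
  proof (cases "x \<in> U \<or> y \<in> U")
    case True
    have "adj x y" if "x \<noteq> y"
    proof (cases "x \<in> U \<and> y \<in> U")
      case False
      then show ?thesis using True UW \<open>x \<in> V\<close> \<open>y \<in> V\<close> adj_sym[of y x] by auto
    qed (use U that in blast)
    then show ?thesis using True by auto
  next
    case False
    then have "adj x y \<longleftrightarrow> odd a \<and> odd b \<and> {x, y} = {x0, y0}" using xy(4) that by simp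
    moreover have "adj x y \<Longrightarrow> x \<noteq> y" by auto
    ultimately show ?thesis using False by argo
  qed
  then have "\<forall>x\<in>V. \<forall>y\<in>V. adj x y \<longleftrightarrow> x \<noteq> y \<and> (x \<in> U \<or> y \<in> U \<or> odd a \<and> odd b \<and> {x, y} = {x0, y0})"
    by simp
  with xy(3) show ?thesis by (intro bexI[OF _ xy(1)] bexI[OF _ xy(2)]) (rule conjI)
qed

end

section \<open>The extremal graph\<close>

text \<open>\<open>GF_E\<close> lists the extra edge in one orientation only; this form is symmetric
  in x and y.\<close>

lemma GF_E_iff:
  "{x, y} \<in> GF_E a b n \<longleftrightarrow> x < n \<and> y < n \<and> x \<noteq> y \<and>
    (x < a div 2 + b div 2 - 1 \<or> y < a div 2 + b div 2 - 1 \<or>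
     odd a \<and> odd b \<and> {x, y} = {a div 2 + b div 2 - 1, Suc (a div 2 + b div 2 - 1)})"
  (is "_ \<longleftrightarrow> ?R")
proof -
  let ?k = "a div 2 + b div 2 - 1"
  have "{x, y} \<in> GF_E a b n \<longleftrightarrow> (\<exists>x' y'. {x, y} = {x', y'} \<and> x' < n \<and> y' < n \<and> x' \<noteq> y' \<and>
      (x' < ?k \<or> y' < ?k \<or> (odd a \<and> odd b \<and> x' = ?k \<and> y' = Suc ?k)))"
    by (simp add: GF_E_def Let_def)
  also have "\<dots> \<longleftrightarrow> ?R"
    unfolding doubleton_eq_iff by (rule iffI) (elim exE conjE, metis, metis)
  finally show ?thesis .
qed

lemma sgraph_GF: "sgraph (GF_E a b n)"
  by unfold_locales (auto simp: GF_E_def Let_def)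

text \<open>A lower bound is enough: the left side bounds the edges of a dense F-free graph from
  above, so the two estimates squeeze.\<close>

lemma card_GF_E_ge:
  assumes k: "k = a div 2 + b div 2 - 1" and n: "Suc k < n"
  shows "k * (k - 1) + 2 * (k * (n - k) + (if odd a \<and> odd b then 1 else 0)) \<le> 2 * card (GF_E a b n)"
proof -
  interpret G: sgraph "GF_E a b n" by (rule sgraph_GF)
  let ?U = "{0..<k}" and ?W = "{k..<n}"
  have adj: "G.adj x y \<longleftrightarrow> x < n \<and> y < n \<and> x \<noteq> y \<and>
      (x < k \<or> y < k \<or> odd a \<and> odd b \<and> {x, y} = {k, Suc k})" for x y
    unfolding G.adj_def GF_E_iff k ..
  have "?U \<union> ?W = {0..<n}" using n by auto
  moreover have "G.edges_in {0..<n} = GF_E a b n"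
    unfolding G.edges_in_def by (auto simp: GF_E_def Let_def)
  ultimately have "card (GF_E a b n) = card (G.edges_in ?U) + card (G.edges_in ?W) + (\<Sum>w\<in>?W. card (G.nb ?U w))"
    using G.card_edges_in_Un[of ?U ?W] by simp
  moreover have "(\<Sum>w\<in>?W. card (G.nb ?U w)) = k * (n - k)"
  proof -
    have "G.nb ?U w = ?U" if "w \<in> ?W" for w using that n by (auto simp: G.nb_def adj)
    then show ?thesis by simp
  qed
  moreover have "2 * card (G.edges_in ?U) = k * (k - 1)"
    using G.card_edges_in_complete_iff[of ?U] n by (simp add: adj)
  moreover have "(if odd a \<and> odd b then 1 else 0) \<le> card (G.edges_in ?W)"
  proof (cases "odd a \<and> odd b")
    case True
    then have "{k, Suc k} \<in> G.edges_in ?W" using n adj[of k "Suc k"] by (simp add: G.edges_in_def G.adj_def)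
    then have "0 < card (G.edges_in ?W)" using G.finite_edges_in[of ?W] by (auto simp: card_gt_0_iff)
    then show ?thesis by simp
  qed auto
  ultimately show ?thesis by simp
qed

lemma graph_iso_GF:
  assumes fin: "finite V" "card V = n" and k: "k = a div 2 + b div 2 - 1"
    and U: "U \<subseteq> V" "card U = k"
    and xy: "x0 \<in> V - U" "y0 \<in> V - U" "odd a \<and> odd b \<longrightarrow> x0 \<noteq> y0"
    and adj: "\<And>x y. x \<in> V \<Longrightarrow> y \<in> V \<Longrightarrow> {x, y} \<in> E \<longleftrightarrow> x \<noteq> y \<and>
      (x \<in> U \<or> y \<in> U \<or> odd a \<and> odd b \<and> {x, y} = {x0, y0})"
  shows "graph_iso V E (GF_V n) (GF_E a b n)"
proof -
  obtain us where us: "set us = U" "distinct us"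
    using finite_distinct_list[of U] fin U finite_subset by metis
  define D where "D = (if odd a \<and> odd b then [x0, y0] else [])"
  have D: "distinct D" "set D \<subseteq> V - U" using xy by (auto simp: D_def)
  obtain ws where ws: "set ws = V - U - set D" "distinct ws"
    using finite_distinct_list[of "V - U - set D"] fin by auto
  \<comment> \<open>The order is that of \<open>GF_E\<close>: first \<open>U\<close>, then the ends
    of the extra edge if there is one, then the rest. The isomorphism \<open>f\<close> sends a
    vertex to its index.\<close>
  define xs where "xs = us @ D @ ws"
  have xs: "distinct xs" "set xs = V" using us ws D U by (auto simp: xs_def)
  have lus: "length us = k" using us U distinct_card by metis
  have lxs: "length xs = n" using xs fin distinct_card by metis
  define f where "f = inv_into {..<n} ((!) xs)"
  have bij: "bij_betw ((!) xs) {..<n} V" using xs lxs by (intro bij_betw_nth) auto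
  have f: "f (xs ! i) = i" if "i < n" for i
    unfolding f_def using bij that by (auto simp: bij_betw_def)
  have inU: "xs ! i \<in> U \<longleftrightarrow> i < k" if "i < n" for i
  proof
    assume "i < k"
    then show "xs ! i \<in> U" using us lus by (auto simp: xs_def nth_append)
  next
    assume *: "xs ! i \<in> U"
    show "i < k"
    proof (rule ccontr)
      assume "\<not> i < k"
      then have "xs ! i = (D @ ws) ! (i - k)" using lus by (simp add: xs_def nth_append)
      moreover have "i - k < length (D @ ws)" using that lxs lus \<open>\<not> i < k\<close> by (simp add: xs_def)
      ultimately have "xs ! i \<in> set (D @ ws)" using nth_mem by metis
      then show False using * D ws by auto
    qed
  qed
  have pair: "{xs ! i, xs ! j} = {x0, y0} \<longleftrightarrow> {i, j} = {k, Suc k}"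
    if "i < n" "j < n" "odd a \<and> odd b" for i j
  proof -
    have D2: "D = [x0, y0]" using that by (simp add: D_def)
    have xk: "xs ! k = x0" "xs ! Suc k = y0" unfolding xs_def D2 using lus by (auto simp: nth_append)
    have kn: "k < n" "Suc k < n" using lxs lus unfolding xs_def D2 by auto
    have "xs ! i' = xs ! j' \<longleftrightarrow> i' = j'" if "i' < n" "j' < n" for i' j'
      using nth_eq_iff_index_eq[OF xs(1)] that lxs by simp
    then show ?thesis unfolding doubleton_eq_iff xk[symmetric] using that kn by simp
  qed
  have "bij_betw f V (GF_V n)"
    using bij_betw_inv_into[OF bij] by (simp add: f_def GF_V_def lessThan_atLeast0)
  moreover have "{x, y} \<in> E \<longleftrightarrow> {f x, f y} \<in> GF_E a b n" if "x \<in> V" "y \<in> V" for x y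
  proof -
    have "x \<in> set xs" "y \<in> set xs" using that xs by auto
    then obtain i j where ij: "i < n" "x = xs ! i" "j < n" "y = xs ! j"
      unfolding in_set_conv_nth lxs by blast
    have ne: "x \<noteq> y \<longleftrightarrow> i \<noteq> j" using ij nth_eq_iff_index_eq[OF xs(1)] lxs by simp
    have fx: "f x = i" "f y = j" using f ij by auto
    have xU: "x \<in> U \<longleftrightarrow> i < k" "y \<in> U \<longleftrightarrow> j < k" using inU ij by auto
    have p: "odd a \<and> odd b \<and> {x, y} = {x0, y0} \<longleftrightarrow> odd a \<and> odd b \<and> {i, j} = {k, Suc k}"
      using pair[OF ij(1,3)] ij(2,4) by blast
    show ?thesis
      unfolding adj[OF that] fx GF_E_iff k[symmetric] ne xU p using ij(1,3) by simp
  qed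
  ultimately show ?thesis unfolding graph_iso_def by blast
qed

section \<open>Translating the forbidden subgraph into paths, and the final assembly\<close>

lemma no_two_disjoint_paths:
  assumes g: "sgraph E" and F: "\<not> contains_subgraph (two_paths_V a b) (two_paths_E a b) V E"
    and p: "sgraph.gpath E p" "set p \<subseteq> V" "a \<le> length p"
    and q: "sgraph.gpath E q" "set q \<subseteq> V" "b \<le> length q" and pq: "set p \<inter> set q = {}"
  shows False
proof -
  interpret sgraph E by (rule g)
  \<comment> \<open>The first a vertices of \<open>p\<close> and the first b vertices of
    \<open>q\<close> carry the copy of the two paths.\<close>
  define f where "f i = (if i < a then p ! i else q ! (i - a))" for i
  have dp: "distinct p" "distinct q" using p q by (auto simp: gpath_def)
  have fp: "f i \<in> set p" if "i < a" for i using that p by (simp add: f_def)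
  have fq: "f i \<in> set q" if "\<not> i < a" "i < a + b" for i using that q by (simp add: f_def)
  have "inj_on f (two_paths_V a b)"
  proof (rule inj_onI)
    fix i j assume ij: "i \<in> two_paths_V a b" "j \<in> two_paths_V a b" "f i = f j"
    then have lt: "i < a + b" "j < a + b" by (auto simp: two_paths_V_def)
    have iff: "i < a \<longleftrightarrow> j < a" using fp[of i] fp[of j] fq[of i] fq[of j] lt ij(3) pq by auto
    show "i = j"
    proof (cases "i < a")
      case True
      then show ?thesis using iff ij(3) p dp nth_eq_iff_index_eq[of p i j] by (simp add: f_def)
    next
      case False
      then have "i - a = j - a"
        using iff ij(3) q dp lt nth_eq_iff_index_eq[of q "i - a" "j - a"] by (simp add: f_def)
      then show ?thesis using iff False by simp
    qed
  qed
  moreover have "f ` two_paths_V a b \<subseteq> V"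
  proof
    fix x assume "x \<in> f ` two_paths_V a b"
    then obtain i where i: "i < a + b" "x = f i" by (auto simp: two_paths_V_def)
    then show "x \<in> V" using fp[of i] fq[of i] p(2) q(2) by (cases "i < a") auto
  qed
  moreover have "f ` e \<in> E" if "e \<in> two_paths_E a b" for e
  proof -
    from that consider i where "e = {i, Suc i}" "Suc i < a" | i where "e = {a + i, a + Suc i}" "Suc i < b"
      by (auto simp: two_paths_E_def)
    then show ?thesis
    proof cases
      case 1
      then show ?thesis using gpath_nth_adj[OF p(1), of i] p(3) by (simp add: f_def adj_def)
    next
      case 2
      then show ?thesis using gpath_nth_adj[OF q(1), of i] q(3) by (simp add: f_def adj_def)
    qed
  qed
  ultimately show False using F unfolding contains_subgraph_def by blast
qed

theorem theorem2p2:
  fixes a b n :: nat and V :: "'a set" and E :: "'a set set"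
  assumes "2 \<le> b" and "b < a"
    and "simple_graph V E" and "card V = n"
    and "\<not> contains_subgraph (two_paths_V a b) (two_paths_E a b) V E"
    and "n \<ge> (a choose (a div 2))^2 * a^4 * b^4"
  shows "card E \<le> card (GF_E a b n) \<and>
         (card E = card (GF_E a b n) \<longrightarrow> graph_iso V E (GF_V n) (GF_E a b n))"
proof (cases "card E < card (GF_E a b n)")
  case True
  then show ?thesis by simp
next
  case False
  have pairs: "\<exists>x y. x \<in> V \<and> y \<in> V \<and> x \<noteq> y \<and> e = {x, y}" if "e \<in> E" for e
    using assms(3) that unfolding simple_graph_def by blast
  have finV: "finite V" using assms(3) by (simp add: simple_graph_def)
  interpret sgraph E by unfold_locales (use pairs in blast)
  interpret two_path_free E V a b
  proof unfold_locales
    fix p q assume "gpath p" "gpath q" "set p \<subseteq> V" "set q \<subseteq> V" "set p \<inter> set q = {}"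
      "a \<le> length p" "b \<le> length q"
    then show False using no_two_disjoint_paths[OF sgraph_axioms assms(5)] by blast
  qed (use finV assms in auto)
  let ?C = "a choose (a div 2)"
  have C1: "1 \<le> ?C * ?C" by (simp add: Suc_le_eq)
  have nn: "144 * (a * a * (?C * ?C)) \<le> n"
  proof -
    \<comment> \<open>144 = 9 * 16 comes from a being at least 3 and b at least 2; a factor a * a of
      the hypothesis is kept for the later estimates.\<close>
    have "9 \<le> a * a" using mult_le_mono[of 3 a 3 a] assms by simp
    moreover have "16 \<le> b ^ 4" using power_mono[of 2 b 4] assms by simp
    ultimately have "9 * 16 \<le> a * a * b ^ 4" by (rule mult_le_mono)
    then have "a * a * (?C * ?C) * 144 \<le> a * a * (?C * ?C) * (a * a * b ^ 4)" by simp
    also have "\<dots> = ?C ^ 2 * a ^ 4 * b ^ 4" by (simp add: power2_eq_square power4_eq_xxxx)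
    finally show ?thesis using assms(6) by linarith
  qed
  have aC: "a * a \<le> a * a * (?C * ?C)" using C1 by simp
  have "a * 1 \<le> a * a" using assms by (intro mult_le_mono2) linarith
  then have an: "144 * a \<le> n" using aC nn by linarith
  have kn: "Suc k < n" using k_ge(4) an assms(1,2) by linarith
  define ex where "ex = (if odd a \<and> odd b then 1 else 0 :: nat)"
  have EV: "edges_in V = E" using pairs by (fastforce simp: edges_in_def)
  have GF: "k * (k - 1) + 2 * (k * (n - k) + ex) \<le> 2 * card (GF_E a b n)"
    unfolding ex_def by (rule card_GF_E_ge[OF k_def kn])
  have "x + 2 * (y + z) \<le> 2 * g \<Longrightarrow> \<not> e < g \<Longrightarrow> x + 2 * y \<le> 2 * e" for x y z g e :: nat
    by simp
  from this[OF GF False] have e: "k * (k - 1) + 2 * (k * (card V - k)) \<le> 2 * card (edges_in V)"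
    unfolding EV assms(4) .
  have kV: "k \<le> card V" using kn assms(4) by linarith
  obtain S where S: "S \<subseteq> V" "\<And>x. x \<in> S \<Longrightarrow> k \<le> card (nb S x)" "card V \<le> 3 * card S + a * a"
    "2 * k * card S \<le> 2 * card (edges_in S) + k * (k + 1)"
    using dense_subset[OF e kV] by metis
  have cS: "143 * (a * a * (?C * ?C)) \<le> 3 * card S" using S(3) nn aC assms(4) by linarith
  have a0: "0 < a * a" using assms by simp
  have "2 * (a * a) < card S" using cS aC a0 by linarith
  then obtain A X where A: "A \<subseteq> S" "card A = a div 2" "X \<subseteq> S" "joined A X"
    and cSX: "card S \<le> 2 * (a * a) + 2 * a * (?C * card X)"
    using large_join[OF S(1,4)] by metis
  have "5 * a * ?C \<le> card X"
  proof (rule ccontr)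
    assume "\<not> ?thesis"
    \<comment> \<open>Otherwise \<open>S\<close> would have at most 12 times a * a * (?C * ?C)
      vertices, while three times its size is at least 143 times that number.\<close>
    then have "2 * a * (?C * card X) \<le> 2 * a * (?C * (5 * a * ?C))" by (intro mult_le_mono2) simp
    also have "\<dots> = 10 * (a * a * (?C * ?C))" by (simp add: algebra_simps)
    finally show False using cSX cS aC a0 by linarith
  qed
  then obtain U X' where U: "U \<subseteq> V" "card U = k" "X' \<subseteq> V" "joined U X'" "4 * a \<le> card X'"
    using joined_k_set[OF S(1,2) A] by blast
  interpret two_path_free_joined E V a b U X' by unfold_locales (use U in auto)
  have ex: "extra = ex" by (simp add: extra_def ex_def)
  have "2 * card E \<le> k * (k - 1) + 2 * (k * (n - k) + ex)"
    using card_edges_le unfolding EV ex assms(4) .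
  \<comment> \<open>The upper bound for \<open>E\<close> and the lower bound for \<open>GF_E\<close>
    agree, so all these numbers coincide.\<close>
  moreover have "2 * e \<le> x \<Longrightarrow> x \<le> 2 * g \<Longrightarrow> \<not> e < g \<Longrightarrow> e = g \<and> 2 * e = x" for e x g :: nat
    by auto
  ultimately have "card E = card (GF_E a b n) \<and> 2 * card E = k * (k - 1) + 2 * (k * (n - k) + ex)"
    using GF False by metis
  then have eq: "card E = card (GF_E a b n)" "2 * card E = k * (k - 1) + 2 * (k * (n - k) + ex)"
    by blast+
  have "2 * card (edges_in V) = k * (k - 1) + 2 * (k * (card V - k) + extra)"
    unfolding EV ex assms(4) by (rule eq(2))
  from card_edges_eq[OF this] obtain x0 y0 where xy: "x0 \<in> V - U" "y0 \<in> V - U" "odd a \<and> odd b \<longrightarrow> x0 \<noteq> y0"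
    and adj: "\<forall>x\<in>V. \<forall>y\<in>V. adj x y \<longleftrightarrow> x \<noteq> y \<and> (x \<in> U \<or> y \<in> U \<or> odd a \<and> odd b \<and> {x, y} = {x0, y0})"
    by (elim bexE conjE)
  have "graph_iso V E (GF_V n) (GF_E a b n)"
    by (rule graph_iso_GF[OF finV assms(4) k_def U(1,2) xy]) (use adj in \<open>simp add: adj_def\<close>)
  then show ?thesis using eq(1) by simp
qed

end
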